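(* Let $f:\mathbb D\to Q_2$ be a conformal Lagrangian immersion of a simply connected domain $\mathbb D$ with conformal coordinate $z$, let $\mathfrak f$ be a horizontal lift of $f$ with invariants $u,\alpha,\beta$, assume $e^{2u}-|\alpha|^2>0$ on $\mathbb D$ (equivalently, $\beta$ has no zeros), and let $\mathrm d+\omega^\lambda$, $\lambda\in\mathbb S^1$, be the associated family of connections (all defined in the context). Then the following statements are equivalent: (1) The Lagrangian immersion $f$ is minimal. (2) The connections $\mathrm d+\omega^\lambda$ are flat for all $\lambda\in\mathbb S^1$, i.e. $\mathrm d\omega^\lambda+\tfrac12[\omega^\lambda\wedge\omega^\lambda]=0$ for all $\lambda\in\mathbb S^1$. (3) The quadratic differential $\alpha\,\mathrm dz^2$ is holomorphic and $\varphi=\arg(\beta)$ is constant.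
   Context: Let $\langle \boldsymbol z,\boldsymbol w\rangle=\sum_{k=1}^4 z_kw_k$ be the complex bilinear form on $\mathbb C^4$. $\mathbb CP^3$ carries the Fubini–Study metric of constant holomorphic sectional curvature $4$, and $Q_2=\{[\boldsymbol z]\in\mathbb CP^3:\langle\boldsymbol z,\boldsymbol z\rangle=0\}$ carries the induced Kähler structure. An immersion of a surface into $Q_2$ is Lagrangian if the Kähler form pulls back to zero; it is minimal if its mean curvature vector in $Q_2$ vanishes. $\mathbb D$ is a simply connected domain of a Riemann surface with conformal coordinate $z=x+iy$, $\partial_z=\frac12(\partial_x-i\partial_y)$, $\partial_{\bar z}=\frac12(\partial_x+i\partial_y)$. For a conformal Lagrangian immersion $f:\mathbb D\to Q_2$ the induced metric is written $2e^u\,\mathrm dz\,\mathrm d\bar z$. A horizontal lift of $f$ is a smooth map $\mathfrak f:\mathbb D\to\mathbb S^7\subset\mathbb C^4$ with $f=[\mathfrak f]$ and $\langle\mathfrak f_z,\bar{\mathfrak f}\rangle=\langle\mathfrak f_{\bar z},\bar{\mathfrak f}\rangle=0$. Put $$\alpha=\langle\mathfrak f_z,\mathfrak f_z\rangle,\qquad \beta=\langle\mathfrak f_z,\mathfrak f_{\bar z}\rangle .$$ One has $\langle \mathfrak f_z,\overline{\mathfrak f_z}\rangle=\langle \mathfrak f_{\bar z},\overline{\mathfrak f_{\bar z}}\rangle=e^u$, $\langle \mathfrak f_z,\overline{\mathfrak f_{\bar z}}\rangle=0$ and $e^{2u}=|\alpha|^2+|\beta|^2$. Frame: let $$\mathcal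 F=\Big(\tfrac1{\sqrt2}(\mathfrak f+\bar{\mathfrak f}),\ -\tfrac{i}{\sqrt2}(\mathfrak f-\bar{\mathfrak f}),\ e_3,\ e_4\Big),\quad e_3=\frac{\mathfrak f_z+\overline{\mathfrak f_z}}{\sqrt{2e^u+\alpha+\bar\alpha}},\quad e_4=-\frac{i\{\mathfrak f_z(e^u+\bar\alpha)-\overline{\mathfrak f_z}(e^u+\alpha)\}}{\sqrt{(2e^u+\alpha+\bar\alpha)(e^{2u}-\alpha\bar\alpha)}} ,$$ whose columns form a real orthonormal basis of $\mathbb R^4$ at each point, and let $\omega=\mathcal F^{-1}\mathrm d\mathcal F$, an $\mathfrak{so}(4)$-valued $1$-form. Decompose $\mathfrak{so}(4)=\mathfrak k\oplus\mathfrak p$ into the $(+1)$- and $(-1)$-eigenspaces of $\mathrm{Ad}\,\mathrm{diag}(1,1,-1,-1)$ (so $\mathfrak k=\mathfrak{so}(2)\oplus\mathfrak{so}(2)$), write $\omega=\omega_{\mathfrak k}+\omega_{\mathfrak p}$, and let $\omega_{\mathfrak p}'$, $\omega_{\mathfrak p}''$ be the $(1,0)$- and $(0,1)$-parts of $\omega_{\mathfrak p}$. Define $$\omega^\lambda=\lambda^{-1}\omega_{\mathfrak p}'+\omega_{\mathfrak k}+\lambda\,\omega_{\mathfrak p}'',\qquad \lambda\in\mathbb S^1 .$$ *)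

theory Defs
  imports "HOL-Analysis.Analysis"
begin

section \<open>Smooth maps and Wirtinger derivatives\<close>

fun Ck_on :: "nat \<Rightarrow> 'a::real_normed_vector set \<Rightarrow> ('a \<Rightarrow> 'b::real_normed_vector) \<Rightarrow> bool" where
  "Ck_on 0 S g \<longleftrightarrow> continuous_on S g"
| "Ck_on (Suc k) S g \<longleftrightarrow>
     (\<forall>p\<in>S. g differentiable (at p)) \<and> (\<forall>v. Ck_on k S (\<lambda>p. frechet_derivative g (at p) v))"

text \<open>Meaningful for open sets only.\<close>
definition smooth_on :: "'a::real_normed_vector set \<Rightarrow> ('a \<Rightarrow> 'b::real_normed_vector) \<Rightarrow> bool" where
  "smooth_on S g \<longleftrightarrow> (\<forall>k. Ck_on k S g)"

definition dir_deriv :: "('a::real_normed_vector \<Rightarrow> 'b::real_normed_vector) \<Rightarrow> 'a \<Rightarrow> 'a \<Rightarrow> 'b" where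
  "dir_deriv g p v = frechet_derivative g (at p) v"

definition wirt_z :: "(complex \<Rightarrow> complex^'n) \<Rightarrow> complex \<Rightarrow> complex^'n" where
  "wirt_z g p = (1/2) *s (dir_deriv g p 1 - \<i> *s dir_deriv g p \<i>)"

definition wirt_zbar :: "(complex \<Rightarrow> complex^'n) \<Rightarrow> complex \<Rightarrow> complex^'n" where
  "wirt_zbar g p = (1/2) *s (dir_deriv g p 1 + \<i> *s dir_deriv g p \<i>)"

section \<open>The complex projective space and the complex quadric\<close>

definition bil :: "complex^4 \<Rightarrow> complex^4 \<Rightarrow> complex" where
  "bil z w = (\<Sum>k\<in>UNIV. z $ k * w $ k)"

definition conjv :: "complex^4 \<Rightarrow> complex^4" where
  "conjv z = (\<chi> k. cnj (z $ k))"

text \<open>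
  The point \<open>[z]\<close> of the complex projective space is represented by the Hermitian
  projector onto the line spanned by \<open>z\<close>. This makes the projective space a submanifold of the
  Euclidean space of complex 4 by 4 matrices, whose inner product is \<open>Re (tr (A B\<^sup>*))\<close>.
\<close>
definition proj_pt :: "complex^4 \<Rightarrow> complex^4^4" where
  "proj_pt z = (\<chi> j k. z $ j * cnj (z $ k) / of_real ((norm z)\<^sup>2))"

definition Q2 :: "(complex^4^4) set" where
  "Q2 = {proj_pt z | z. z \<noteq> 0 \<and> bil z z = 0}"

text \<open>
  With the factor 1/2 the Hopf map from the unit sphere is a Riemannian submersion
  (lemmas \<open>has_derivative_proj_pt\<close> and \<open>fs_metric_hopf\<close> below), so that this is the Fubini--Study
  metric of constant holomorphic sectional curvature 4.
\<close>
definition fs_metric :: "complex^4^4 \<Rightarrow> complex^4^4 \<Rightarrow> real" where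
  "fs_metric X Y = (X \<bullet> Y) / 2"

text \<open>
  Complex structure on the tangent space of the projective space at \<open>P\<close>; see lemma \<open>fs_J_hopf\<close>.
\<close>
definition fs_J :: "complex^4^4 \<Rightarrow> complex^4^4 \<Rightarrow> complex^4^4" where
  "fs_J P X = (\<chi> j k. \<i> * (X ** P - P ** X) $ j $ k)"

definition kaehler_form :: "complex^4^4 \<Rightarrow> complex^4^4 \<Rightarrow> complex^4^4 \<Rightarrow> real" where
  "kaehler_form P X Y = fs_metric (fs_J P X) Y"

text \<open>The matrix \<open>v p\<^sup>* + p v\<^sup>*\<close>, the differential of the Hopf map on horizontal vectors.\<close>
definition hopf_diff :: "complex^4 \<Rightarrow> complex^4 \<Rightarrow> complex^4^4" where
  "hopf_diff p v = (\<chi> j k. v $ j * cnj (p $ k) + p $ j * cnj (v $ k))"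

section \<open>Surfaces in submanifolds\<close>

definition tangent_space :: "(complex^4^4) set \<Rightarrow> complex^4^4 \<Rightarrow> (complex^4^4) set" where
  "tangent_space N P =
     {X. \<exists>\<epsilon>>0. \<exists>c :: real \<Rightarrow> complex^4^4.
        smooth_on {-\<epsilon><..<\<epsilon>} c \<and> c ` {-\<epsilon><..<\<epsilon>} \<subseteq> N \<and> c 0 = P \<and>
        (c has_vector_derivative X) (at 0)}"

definition orth_proj :: "(complex^4^4) set \<Rightarrow> complex^4^4 \<Rightarrow> complex^4^4" where
  "orth_proj W X = (THE Y. Y \<in> W \<and> (\<forall>Z\<in>W. fs_metric (X - Y) Z = 0))"

definition immersion_into ::
  "(complex^4^4) set \<Rightarrow> complex set \<Rightarrow> (complex \<Rightarrow> complex^4^4) \<Rightarrow> bool" where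
  "immersion_into N D f \<longleftrightarrow> smooth_on D f \<and> f ` D \<subseteq> N \<and> (\<forall>p\<in>D. inj (dir_deriv f p))"

definition conformal_map :: "complex set \<Rightarrow> (complex \<Rightarrow> complex^4^4) \<Rightarrow> bool" where
  "conformal_map D f \<longleftrightarrow>
     (\<forall>p\<in>D. \<exists>\<rho>>0. \<forall>v w. fs_metric (dir_deriv f p v) (dir_deriv f p w) = \<rho> * (v \<bullet> w))"

definition lagrangian_map :: "complex set \<Rightarrow> (complex \<Rightarrow> complex^4^4) \<Rightarrow> bool" where
  "lagrangian_map D f \<longleftrightarrow>
     (\<forall>p\<in>D. \<forall>v w. kaehler_form (f p) (dir_deriv f p v) (dir_deriv f p w) = 0)"

text \<open>
  The metric of \<open>N\<close> is induced from a Euclidean space, so its Levi-Civita connection along \<open>f\<close>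
  is the tangential part of the ordinary derivative.
\<close>
definition levi_civita ::
  "(complex^4^4) set \<Rightarrow> (complex \<Rightarrow> complex^4^4) \<Rightarrow> complex \<Rightarrow> complex \<Rightarrow> complex \<Rightarrow> complex^4^4" where
  "levi_civita N f p v w =
     orth_proj (tangent_space N (f p)) (dir_deriv (\<lambda>q. dir_deriv f q w) p v)"

definition normal_space ::
  "(complex^4^4) set \<Rightarrow> (complex \<Rightarrow> complex^4^4) \<Rightarrow> complex \<Rightarrow> (complex^4^4) set" where
  "normal_space N f p = {X \<in> tangent_space N (f p). \<forall>v. fs_metric X (dir_deriv f p v) = 0}"

definition second_ff ::
  "(complex^4^4) set \<Rightarrow> (complex \<Rightarrow> complex^4^4) \<Rightarrow> complex \<Rightarrow> complex \<Rightarrow> complex \<Rightarrow> complex^4^4" where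
  "second_ff N f p v w = orth_proj (normal_space N f p) (levi_civita N f p v w)"

text \<open>Half the trace of the second fundamental form with respect to the induced metric.\<close>
definition mean_curvature_vector ::
  "(complex^4^4) set \<Rightarrow> (complex \<Rightarrow> complex^4^4) \<Rightarrow> complex \<Rightarrow> complex^4^4" where
  "mean_curvature_vector N f p =
     (let E = fs_metric (dir_deriv f p 1) (dir_deriv f p 1);
          F = fs_metric (dir_deriv f p 1) (dir_deriv f p \<i>);
          G = fs_metric (dir_deriv f p \<i>) (dir_deriv f p \<i>)
      in (1 / (2 * (E * G - F\<^sup>2))) *\<^sub>R
         (G *\<^sub>R second_ff N f p 1 1 - (2 * F) *\<^sub>R second_ff N f p 1 \<i> + E *\<^sub>R second_ff N f p \<i> \<i>))"

definition minimal_in :: "(complex^4^4) set \<Rightarrow> complex set \<Rightarrow> (complex \<Rightarrow> complex^4^4) \<Rightarrow> bool" where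
  "minimal_in N D f \<longleftrightarrow> (\<forall>p\<in>D. mean_curvature_vector N f p = 0)"

text \<open>\<open>2 e\<^sup>u dz dzbar = 2 e\<^sup>u (dx\<^sup>2 + dy\<^sup>2)\<close>\<close>
definition induced_metric_is :: "complex set \<Rightarrow> (complex \<Rightarrow> complex^4^4) \<Rightarrow> (complex \<Rightarrow> real) \<Rightarrow> bool" where
  "induced_metric_is D f u \<longleftrightarrow>
     (\<forall>p\<in>D. \<forall>v w. fs_metric (dir_deriv f p v) (dir_deriv f p w) = 2 * exp (u p) * (v \<bullet> w))"

section \<open>Horizontal lifts and their invariants\<close>

definition horizontal_lift ::
  "complex set \<Rightarrow> (complex \<Rightarrow> complex^4^4) \<Rightarrow> (complex \<Rightarrow> complex^4) \<Rightarrow> bool" where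
  "horizontal_lift D f F \<longleftrightarrow>
     smooth_on D F \<and> F ` D \<subseteq> sphere 0 1 \<and> (\<forall>p\<in>D. f p = proj_pt (F p)) \<and>
     (\<forall>p\<in>D. bil (wirt_z F p) (conjv (F p)) = 0 \<and> bil (wirt_zbar F p) (conjv (F p)) = 0)"

definition alpha :: "(complex \<Rightarrow> complex^4) \<Rightarrow> complex \<Rightarrow> complex" where
  "alpha F p = bil (wirt_z F p) (wirt_z F p)"

definition beta :: "(complex \<Rightarrow> complex^4) \<Rightarrow> complex \<Rightarrow> complex" where
  "beta F p = bil (wirt_z F p) (wirt_zbar F p)"

text \<open>
  Under the square roots, \<open>2 Re \<alpha> = \<alpha> + cnj \<alpha>\<close> and \<open>(cmod \<alpha>)\<^sup>2 = \<alpha> * cnj \<alpha>\<close>.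
\<close>
definition e3 :: "(complex \<Rightarrow> real) \<Rightarrow> (complex \<Rightarrow> complex^4) \<Rightarrow> complex \<Rightarrow> complex^4" where
  "e3 u F p = (1 / of_real (sqrt (2 * exp (u p) + 2 * Re (alpha F p)))) *s
     (wirt_z F p + conjv (wirt_z F p))"

definition e4 :: "(complex \<Rightarrow> real) \<Rightarrow> (complex \<Rightarrow> complex^4) \<Rightarrow> complex \<Rightarrow> complex^4" where
  "e4 u F p =
     (- \<i> / of_real (sqrt ((2 * exp (u p) + 2 * Re (alpha F p)) *
                            (exp (2 * u p) - (cmod (alpha F p))\<^sup>2)))) *s
     ((of_real (exp (u p)) + cnj (alpha F p)) *s wirt_z F p
      - (of_real (exp (u p)) + alpha F p) *s conjv (wirt_z F p))"

text \<open>
  The columns have real entries; they are kept in a complex matrix because the connection forms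
  below take values in the complexification of \<open>so(4)\<close>.
\<close>
definition frame :: "(complex \<Rightarrow> real) \<Rightarrow> (complex \<Rightarrow> complex^4) \<Rightarrow> complex \<Rightarrow> complex^4^4" where
  "frame u F p = (\<chi> j k.
     if k = 1 then ((1 / of_real (sqrt 2)) *s (F p + conjv (F p))) $ j
     else if k = 2 then ((- \<i> / of_real (sqrt 2)) *s (F p - conjv (F p))) $ j
     else if k = 3 then e3 u F p $ j
     else e4 u F p $ j)"

section \<open>Matrix-valued one-forms\<close>

text \<open>A one-form assigns to a point and a tangent vector (real-linearly) a matrix.\<close>
type_synonym mform = "complex \<Rightarrow> complex \<Rightarrow> complex^4^4"

definition cscale :: "complex \<Rightarrow> complex^4^4 \<Rightarrow> complex^4^4" where
  "cscale c A = (\<chi> j k. c * A $ j $ k)"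

definition maurer_cartan :: "(complex \<Rightarrow> complex^4^4) \<Rightarrow> mform" where
  "maurer_cartan M = (\<lambda>p v. matrix_inv (M p) ** dir_deriv M p v)"

definition sigma :: "complex^4^4" where
  "sigma = (\<chi> j k. if j = k then (if j = 1 \<or> j = 2 then 1 else - 1) else 0)"

text \<open>Projections to the eigenspaces of \<open>Ad sigma\<close>; note that \<open>sigma\<close> is its own inverse.\<close>
definition k_part :: "mform \<Rightarrow> mform" where
  "k_part \<eta> = (\<lambda>p v. (1/2) *\<^sub>R (\<eta> p v + sigma ** \<eta> p v ** sigma))"

definition p_part :: "mform \<Rightarrow> mform" where
  "p_part \<eta> = (\<lambda>p v. (1/2) *\<^sub>R (\<eta> p v - sigma ** \<eta> p v ** sigma))"

definition part10 :: "mform \<Rightarrow> mform" where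
  "part10 \<eta> = (\<lambda>p v. (1/2) *\<^sub>R (\<eta> p v - cscale \<i> (\<eta> p (\<i> * v))))"

definition part01 :: "mform \<Rightarrow> mform" where
  "part01 \<eta> = (\<lambda>p v. (1/2) *\<^sub>R (\<eta> p v + cscale \<i> (\<eta> p (\<i> * v))))"

definition loop_form :: "mform \<Rightarrow> complex \<Rightarrow> mform" where
  "loop_form \<omega> l = (\<lambda>p v. cscale (inverse l) (part10 (p_part \<omega>) p v) + k_part \<omega> p v
                        + cscale l (part01 (p_part \<omega>) p v))"

definition ext_deriv :: "mform \<Rightarrow> complex \<Rightarrow> complex \<Rightarrow> complex \<Rightarrow> complex^4^4" where
  "ext_deriv \<eta> p v w = dir_deriv (\<lambda>q. \<eta> q w) p v - dir_deriv (\<lambda>q. \<eta> q v) p w"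

definition comm :: "complex^4^4 \<Rightarrow> complex^4^4 \<Rightarrow> complex^4^4" where
  "comm A B = A ** B - B ** A"

definition wedge_bracket :: "mform \<Rightarrow> mform \<Rightarrow> complex \<Rightarrow> complex \<Rightarrow> complex \<Rightarrow> complex^4^4" where
  "wedge_bracket \<eta> \<theta> p v w = comm (\<eta> p v) (\<theta> p w) - comm (\<eta> p w) (\<theta> p v)"

definition flat_connection :: "complex set \<Rightarrow> mform \<Rightarrow> bool" where
  "flat_connection D \<eta> \<longleftrightarrow>
     (\<forall>p\<in>D. \<forall>v w. ext_deriv \<eta> p v w + (1/2) *\<^sub>R wedge_bracket \<eta> \<eta> p v w = 0)"

section \<open>Compatibility of the projector model with the Hopf fibration\<close>

lemma power2_norm_C4: "complex_of_real ((norm z)\<^sup>2) = (\<Sum>k\<in>UNIV. z $ k * cnj (z $ k))"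
  for z :: "complex^4"
  by (simp only: power2_norm_eq_inner inner_vec_def of_real_sum)
     (simp add: complex_eq_iff inner_complex_def power2_eq_square sum_4)

lemma has_derivative_proj_pt:
  assumes "norm p = 1"
  shows "(proj_pt has_derivative (\<lambda>v. hopf_diff p v - (2 * (p \<bullet> v)) *\<^sub>R proj_pt p)) (at p)"
proof -
  define B where "B z w = (\<chi> j k. z $ j * cnj (w $ k))" for z w :: "complex^4"
  have "bilinear B"
    unfolding bilinear_def
    by (auto intro!: linearI simp: B_def vec_eq_iff algebra_simps scaleR_conv_of_real[where 'a=complex])
  then have "bounded_bilinear B"
    by (simp add: bilinear_conv_bounded_bilinear)
  then have "((\<lambda>z. B z z) has_derivative (\<lambda>v. B p v + B v p)) (at p)"
    by (rule bounded_bilinear.FDERIV) (rule has_derivative_ident)+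
  moreover have "(\<lambda>v. B p v + B v p) = hopf_diff p"
    by (auto simp: fun_eq_iff vec_eq_iff B_def hopf_diff_def)
  ultimately have T: "((\<lambda>z. B z z) has_derivative hopf_diff p) (at p)"
    by simp
  have n: "((\<lambda>z. inverse (z \<bullet> z)) has_derivative (\<lambda>v. - (2 * (p \<bullet> v)))) (at p)"
    using assms
    by (auto intro!: derivative_eq_intros simp: dot_square_norm inner_commute)
  have eq: "proj_pt = (\<lambda>z. inverse (z \<bullet> z) *\<^sub>R B z z)"
    by (auto simp: fun_eq_iff vec_eq_iff proj_pt_def B_def scaleR_conv_of_real[where 'a=complex] dot_square_norm field_simps)
  have one: "p \<bullet> p = 1" using assms by (simp add: dot_square_norm)
  have Tp: "B p p = proj_pt p" unfolding eq using one by simp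
  show ?thesis
    unfolding eq
    by (rule has_derivative_eq_rhs[OF has_derivative_scaleR[OF n T]])
       (simp add: fun_eq_iff one)
qed

lemma fs_metric_hopf:
  assumes "norm p = 1" "bil v (conjv p) = 0" "bil w (conjv p) = 0"
  shows "fs_metric (hopf_diff p v) (hopf_diff p w) = Re (bil v (conjv w))"
proof -
  have ip: "X \<bullet> Y = Re (\<Sum>j\<in>UNIV. \<Sum>k\<in>UNIV. X $ j $ k * cnj (Y $ j $ k))" for X Y :: "complex^4^4"
    by (simp add: inner_vec_def inner_complex_def)
  have p: "(\<Sum>k\<in>UNIV. p $ k * cnj (p $ k)) = 1"
    using power2_norm_C4[of p] assms by simp
  have v: "(\<Sum>k\<in>UNIV. v $ k * cnj (p $ k)) = 0" and w: "(\<Sum>k\<in>UNIV. w $ k * cnj (p $ k)) = 0"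
    using assms by (simp_all add: bil_def conjv_def)
  have w': "(\<Sum>k\<in>UNIV. p $ k * cnj (w $ k)) = 0"
    using arg_cong[OF w, of cnj] by (simp add: mult.commute)
  define S where "S = (\<Sum>k\<in>UNIV. v $ k * cnj (w $ k))"
  have S': "(\<Sum>k\<in>UNIV. w $ k * cnj (v $ k)) = cnj S"
    by (simp add: S_def mult.commute)
  have "(\<Sum>j\<in>UNIV. \<Sum>k\<in>UNIV. hopf_diff p v $ j $ k * cnj (hopf_diff p w $ j $ k)) =
     (\<Sum>j\<in>UNIV. v $ j * cnj (w $ j)) * (\<Sum>k\<in>UNIV. p $ k * cnj (p $ k))
   + (\<Sum>j\<in>UNIV. v $ j * cnj (p $ j)) * (\<Sum>k\<in>UNIV. w $ k * cnj (p $ k))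
   + (\<Sum>j\<in>UNIV. p $ j * cnj (w $ j)) * (\<Sum>k\<in>UNIV. p $ k * cnj (v $ k))
   + (\<Sum>j\<in>UNIV. p $ j * cnj (p $ j)) * (\<Sum>k\<in>UNIV. w $ k * cnj (v $ k))"
    by (simp add: hopf_diff_def sum_4 algebra_simps)
  also have "\<dots> = S + cnj S"
    by (simp add: p v w w' S' S_def[symmetric])
  finally show ?thesis
    by (simp add: fs_metric_def ip bil_def conjv_def S_def[symmetric])
qed

lemma fs_J_hopf:
  assumes "norm p = 1" "bil v (conjv p) = 0"
  shows "fs_J (proj_pt p) (hopf_diff p v) = hopf_diff p (\<i> *s v)"
proof -
  have p: "(\<Sum>k\<in>UNIV. cnj (p $ k) * p $ k) = 1"
    using power2_norm_C4[of p] assms by (simp add: mult.commute)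
  have v: "(\<Sum>k\<in>UNIV. cnj (p $ k) * v $ k) = 0"
    using assms by (simp add: bil_def conjv_def mult.commute)
  have v': "(\<Sum>k\<in>UNIV. cnj (v $ k) * p $ k) = 0"
    using arg_cong[OF v, of cnj] by (simp add: mult.commute)
  have 1: "(hopf_diff p v ** proj_pt p) $ j $ k =
      v $ j * cnj (p $ k) * (\<Sum>l\<in>UNIV. cnj (p $ l) * p $ l)
      + p $ j * cnj (p $ k) * (\<Sum>l\<in>UNIV. cnj (v $ l) * p $ l)" for j k
    by (simp add: matrix_matrix_mult_def hopf_diff_def proj_pt_def assms sum_4 algebra_simps)
  have 2: "(proj_pt p ** hopf_diff p v) $ j $ k =
      p $ j * cnj (p $ k) * (\<Sum>l\<in>UNIV. cnj (p $ l) * v $ l)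
      + p $ j * cnj (v $ k) * (\<Sum>l\<in>UNIV. cnj (p $ l) * p $ l)" for j k
    by (simp add: matrix_matrix_mult_def hopf_diff_def proj_pt_def assms sum_4 algebra_simps)
  show ?thesis
    by (simp add: fs_J_def vec_eq_iff 1 2 p v v') (simp add: hopf_diff_def algebra_simps)
qed

end

theory Submission
  imports Defs
begin

text \<open>
  All three statements say that the component \<open>h\<close> of the coordinate Laplacian of the lift \<open>F\<close> orthogonal to
  \<open>F\<close> and to its conjugate vanishes.
  The tangent space of \<open>Q2\<close> at \<open>[F]\<close> lifts to the complex orthogonal complement of \<open>F\<close> and its conjugate,
  so in conformal coordinates the mean curvature vector lifts to a multiple of \<open>h\<close>.
  With \<open>l = cos t + \<i> sin t\<close>, the Maurer--Cartan equation reduces the curvature of the connection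
  with parameter \<open>l\<close> to \<open>sin t\<close> times a skew matrix whose entries are the products of \<open>e3\<close>, \<open>e4\<close>
  with the Laplacians of the first two columns of the frame, that is with \<open>h\<close> and its conjugate.
  Finally, \<open>(F\<^sub>x, F\<^sub>y)\<close> is up to scale a unitary frame whose squared determinant is a positive multiple
  of \<open>- \<beta>\<^sup>2\<close>, so the differential of \<open>arg \<beta>\<close> is a nonvanishing multiple of the Hermitian product of \<open>h\<close>
  with the differential of \<open>F\<close>; and \<open>\<alpha>\<close> is holomorphic as soon as \<open>h = 0\<close>.
\<close>

section \<open>Calculus of smooth maps\<close>

text \<open>The equation hidden behind (2) is the harmonic map equation: a point [F] of the quadric
  corresponds to the oriented plane spanned by the real and imaginary parts of F, the first two
  columns of the frame, so f is a map into the Grassmannian SO(4)/(SO(2) x SO(2)). Flatness at the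
  parameter 1 is automatic because the frame exists; the other parameters add one equation, and for
  a conformal immersion harmonic means minimal. Arguing with h instead of structure equations in u,
  \<alpha>, \<beta> keeps the long formulas for \<open>e3\<close> and \<open>e4\<close> out of the
  calculation. Their square roots are shown to be smooth but never differentiated explicitly:
  horizontality of the lift makes the upper left block of the connection form vanish, so second
  derivatives matter only for the first two columns, and \<open>e3\<close>, \<open>e4\<close> enter
  as an orthonormal basis of the horizontal space. Two objects resist direct differentiation.
  Smoothness of u is not given, so derivatives of the metric are taken on the Hermitian product of
  F_x with itself. \<open>Arg\<close> jumps across the negative axis, so its constancy is treated
  through the unit vector \<beta>/|\<beta>|.\<close>

lemma Ck_on_cong:
  assumes "open S" "\<And>p. p \<in> S \<Longrightarrow> f p = g p" "Ck_on k S f"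
  shows "Ck_on k S g"
  using assms(2,3)
proof (induction k arbitrary: f g)
  case 0
  then show ?case by (auto cong: continuous_on_cong)
next
  case (Suc k)
  have fr: "g differentiable (at p)" "frechet_derivative f (at p) = frechet_derivative g (at p)" if "p \<in> S" for p
  proof -
    have "f differentiable (at p)" using Suc.prems that by simp
    then have d: "(f has_derivative frechet_derivative f (at p)) (at p)"
      by (simp add: frechet_derivative_works)
    have "(g has_derivative frechet_derivative f (at p)) (at p)"
      by (rule has_derivative_transform_within_open[OF d \<open>open S\<close> that]) (use Suc.prems in auto)
    then show "g differentiable (at p)" "frechet_derivative f (at p) = frechet_derivative g (at p)"
      by (auto simp: differentiable_def dest: frechet_derivative_at)
  qed
  have "Ck_on k S (\<lambda>p. frechet_derivative g (at p) v)" for v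
    by (rule Suc.IH[of "\<lambda>p. frechet_derivative f (at p) v"]) (use Suc.prems fr in auto)
  with fr show ?case by auto
qed

lemma Ck_on_SucI:
  assumes "open S" "\<And>p. p \<in> S \<Longrightarrow> (g has_derivative g' p) (at p)"
    "\<And>v. Ck_on k S (\<lambda>p. g' p v)"
  shows "Ck_on (Suc k) S g"
proof -
  have "frechet_derivative g (at p) = g' p" if "p \<in> S" for p
    using frechet_derivative_at assms(2)[OF that] by metis
  then have "Ck_on k S (\<lambda>p. frechet_derivative g (at p) v)" for v
    by (intro Ck_on_cong[OF assms(1) _ assms(3)]) auto
  then show ?thesis using assms(2) by (auto simp: differentiable_def)
qed

lemma Ck_on_Suc_has_derivative:
  assumes "Ck_on (Suc k) S g" "p \<in> S"
  shows "(g has_derivative dir_deriv g p) (at p)"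
  using assms unfolding dir_deriv_def[abs_def] by (simp add: frechet_derivative_works)

lemma Ck_on_Suc_dir_deriv: "Ck_on (Suc k) S g \<Longrightarrow> Ck_on k S (\<lambda>p. dir_deriv g p v)"
  by (simp add: dir_deriv_def)

lemma Ck_on_SucD: "Ck_on (Suc k) S g \<Longrightarrow> Ck_on k S g"
proof (induction k arbitrary: g)
  case 0
  then show ?case
    by (auto intro!: continuous_at_imp_continuous_on differentiable_imp_continuous_within)
next
  case (Suc k)
  from Suc.prems have "\<forall>p\<in>S. g differentiable (at p)"
    and "\<forall>v. Ck_on (Suc k) S (\<lambda>p. frechet_derivative g (at p) v)"
    by (auto simp only: Ck_on.simps(2)[of "Suc k" S g])
  with Suc.IH show ?case by simp
qed

lemma Ck_on_const: "open S \<Longrightarrow> Ck_on k S (\<lambda>p. c)"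
proof (induction k arbitrary: c)
  case (Suc k)
  show ?case
    by (rule Ck_on_SucI[OF Suc.prems has_derivative_const]) (use Suc in auto)
qed simp

lemma Ck_on_add:
  assumes "open S" shows "Ck_on k S f \<Longrightarrow> Ck_on k S g \<Longrightarrow> Ck_on k S (\<lambda>p. f p + g p)"
proof (induction k arbitrary: f g)
  case 0 then show ?case by (auto intro: continuous_intros)
next
  case (Suc k)
  show ?case
    by (rule Ck_on_SucI[OF assms has_derivative_add[OF Ck_on_Suc_has_derivative[OF Suc.prems(1)] Ck_on_Suc_has_derivative[OF Suc.prems(2)]]])
      (assumption | rule Suc.IH Ck_on_Suc_dir_deriv Suc.prems)+
qed

lemma Ck_on_linear:
  assumes "open S" "bounded_linear L" shows "Ck_on k S f \<Longrightarrow> Ck_on k S (\<lambda>p. L (f p))"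
proof (induction k arbitrary: f)
  case 0 then show ?case by (auto intro: bounded_linear.continuous_on[OF assms(2)])
next
  case (Suc k)
  show ?case
    by (rule Ck_on_SucI[OF assms(1) bounded_linear.has_derivative[OF assms(2) Ck_on_Suc_has_derivative[OF Suc.prems]]])
      (assumption | rule Suc.IH Ck_on_Suc_dir_deriv Suc.prems)+
qed

lemma Ck_on_bilinear:
  assumes "open S" "bounded_bilinear B"
  shows "Ck_on k S f \<Longrightarrow> Ck_on k S g \<Longrightarrow> Ck_on k S (\<lambda>p. B (f p) (g p))"
proof (induction k arbitrary: f g)
  case 0 then show ?case by (auto intro: bounded_bilinear.continuous_on[OF assms(2)])
next
  case (Suc k)
  show ?case
    by (rule Ck_on_SucI[OF assms(1) bounded_bilinear.FDERIV[OF assms(2) Ck_on_Suc_has_derivative[OF Suc.prems(1)] Ck_on_Suc_has_derivative[OF Suc.prems(2)]]])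
      (assumption | rule Ck_on_add[OF assms(1)] Suc.IH[OF Ck_on_SucD[OF Suc.prems(1)] Ck_on_Suc_dir_deriv[OF Suc.prems(2)]]
        Suc.IH[OF Ck_on_Suc_dir_deriv[OF Suc.prems(1)] Ck_on_SucD[OF Suc.prems(2)]])+
qed

lemma Ck_on_id: "open S \<Longrightarrow> Ck_on k S (\<lambda>p. p)"
proof (cases k)
  case (Suc n)
  assume "open S"
  then show ?thesis
    unfolding Suc by (rule Ck_on_SucI[OF _ has_derivative_ident]) (auto intro: Ck_on_const \<open>open S\<close>)
qed auto

text \<open>Differentiating 1/f reproduces 1/f next to f', so regularity bootstraps: order k for 1/f
  gives order k for its derivative. The square root below bootstraps in the same way.\<close>

lemma Ck_on_inverse:
  fixes f :: "'a::real_normed_vector \<Rightarrow> real"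
  assumes "open S" "\<And>p. p \<in> S \<Longrightarrow> f p \<noteq> 0"
  shows "Ck_on k S f \<Longrightarrow> Ck_on k S (\<lambda>p. inverse (f p))"
proof (induction k)
  case 0 then show ?case using assms(2) by (auto intro: continuous_intros)
next
  case (Suc k)
  note mult = Ck_on_bilinear[OF assms(1) bounded_bilinear_mult]
  have I: "Ck_on k S (\<lambda>p. inverse (f p))" by (rule Suc.IH[OF Ck_on_SucD[OF Suc.prems]])
  show ?case
  proof (rule Ck_on_SucI[OF assms(1)])
    show "((\<lambda>p. inverse (f p)) has_derivative (\<lambda>v. (- 1) * (inverse (f p) * dir_deriv f p v * inverse (f p)))) (at p)"
      if "p \<in> S" for p
      using Deriv.has_derivative_inverse[OF assms(2)[OF that] Ck_on_Suc_has_derivative[OF Suc.prems that]] by simp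
    show "Ck_on k S (\<lambda>p. (- 1) * (inverse (f p) * dir_deriv f p v * inverse (f p)))" for v
      by (rule mult Ck_on_const assms(1) I Ck_on_Suc_dir_deriv Suc.prems)+
  qed
qed

lemma Ck_on_sqrt:
  fixes f :: "'a::real_normed_vector \<Rightarrow> real"
  assumes "open S" "\<And>p. p \<in> S \<Longrightarrow> f p > 0"
  shows "Ck_on k S f \<Longrightarrow> Ck_on k S (\<lambda>p. sqrt (f p))"
proof (induction k)
  case 0 then show ?case using continuous_on_real_sqrt by simp
next
  case (Suc k)
  note mult = Ck_on_bilinear[OF assms(1) bounded_bilinear_mult]
  have I: "Ck_on k S (\<lambda>p. inverse (sqrt (f p)))"
  proof (rule Ck_on_inverse[OF assms(1) _ Suc.IH[OF Ck_on_SucD[OF Suc.prems]]])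
    show "sqrt (f p) \<noteq> 0" if "p \<in> S" for p
      using assms(2)[OF that] by simp
  qed
  show ?case
  proof (rule Ck_on_SucI[OF assms(1)])
    show "((\<lambda>p. sqrt (f p)) has_derivative (\<lambda>v. dir_deriv f p v * (inverse (sqrt (f p)) * (1/2)))) (at p)"
      if "p \<in> S" for p
      by (rule has_derivative_eq_rhs[OF DERIV_compose_FDERIV[OF DERIV_real_sqrt[OF assms(2)[OF that]]
            Ck_on_Suc_has_derivative[OF Suc.prems that]]]) (simp add: fun_eq_iff field_simps)
    show "Ck_on k S (\<lambda>p. dir_deriv f p v * (inverse (sqrt (f p)) * (1/2)))" for v
      by (rule mult[OF Ck_on_Suc_dir_deriv[OF Suc.prems] mult[OF I Ck_on_const[OF assms(1)]]])
  qed
qed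

lemma Ck_on_sum:
  assumes "open S" "\<And>i. i \<in> I \<Longrightarrow> Ck_on k S (f i)"
  shows "Ck_on k S (\<lambda>p. \<Sum>i\<in>I. f i p)"
  using assms(2)
  by (induction I rule: infinite_finite_induct) (auto intro: Ck_on_const Ck_on_add assms(1))

lemma bounded_linear_axis: "bounded_linear (\<lambda>x::'a::euclidean_space. axis i x :: 'a^'n)"
  unfolding linear_conv_bounded_linear[symmetric]
  by (auto intro!: linearI simp: vec_eq_iff axis_def)

lemma Ck_on_vec:
  fixes f :: "'n::finite \<Rightarrow> 'b::real_normed_vector \<Rightarrow> 'a::euclidean_space"
  assumes "open S" "\<And>i. Ck_on k S (f i)"
  shows "Ck_on k S (\<lambda>p. \<chi> i. f i p)"
proof -
  have "(\<lambda>p. \<chi> i. f i p) = (\<lambda>p. \<Sum>i\<in>UNIV. axis i (f i p))"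
    by (auto simp: vec_eq_iff axis_def fun_eq_iff)
  then show ?thesis
    using Ck_on_sum[OF assms(1) Ck_on_linear[OF assms(1) bounded_linear_axis assms(2)]] by simp
qed

lemma Ck_on_nth: "open S \<Longrightarrow> Ck_on k S f \<Longrightarrow> Ck_on k S (\<lambda>p. f p $ i)"
  by (rule Ck_on_linear[OF _ bounded_linear_vec_nth])

lemma smooth_on_dir_deriv: "smooth_on S f \<Longrightarrow> smooth_on S (\<lambda>p. dir_deriv f p v)"
  unfolding smooth_on_def using Ck_on_Suc_dir_deriv by blast

lemma smooth_on_has_derivative:
  "smooth_on S f \<Longrightarrow> p \<in> S \<Longrightarrow> (f has_derivative dir_deriv f p) (at p)"
  unfolding smooth_on_def using Ck_on_Suc_has_derivative by blast

lemma smooth_on_cong: "open S \<Longrightarrow> (\<And>p. p \<in> S \<Longrightarrow> f p = g p) \<Longrightarrow> smooth_on S f \<Longrightarrow> smooth_on S g"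
  unfolding smooth_on_def using Ck_on_cong by blast

lemma smooth_on_add:
  "open S \<Longrightarrow> smooth_on S f \<Longrightarrow> smooth_on S g \<Longrightarrow> smooth_on S (\<lambda>p. f p + g p)"
  by (simp add: smooth_on_def Ck_on_add)

lemma smooth_on_linear:
  "bounded_linear L \<Longrightarrow> open S \<Longrightarrow> smooth_on S f \<Longrightarrow> smooth_on S (\<lambda>p. L (f p))"
  unfolding smooth_on_def by (intro allI, rule Ck_on_linear, assumption+, erule spec)

lemma smooth_on_bilinear:
  "bounded_bilinear B \<Longrightarrow> open S \<Longrightarrow> smooth_on S f \<Longrightarrow> smooth_on S g \<Longrightarrow>
    smooth_on S (\<lambda>p. B (f p) (g p))"
  unfolding smooth_on_def by (intro allI, rule Ck_on_bilinear, assumption+, (erule spec)+)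

lemma dir_deriv_eq: "(f has_derivative f') (at p) \<Longrightarrow> dir_deriv f p v = f' v"
  unfolding dir_deriv_def by (metis frechet_derivative_at)

lemma dir_deriv_cong_open:
  assumes "open S" "p \<in> S" "\<And>q. q \<in> S \<Longrightarrow> f q = g q"
  shows "dir_deriv f p v = dir_deriv g p v"
proof -
  have "(f has_derivative f') (at p) = (g has_derivative f') (at p)" for f'
    using has_derivative_transform_within_open[OF _ assms(1,2), of f f' UNIV g]
      has_derivative_transform_within_open[OF _ assms(1,2), of g f' UNIV f] assms(3) by auto
  then show ?thesis by (simp add: dir_deriv_def frechet_derivative_def)
qed

section \<open>Symmetry of second derivatives\<close>

lemma smooth_on_has_derivative_line:
  fixes g :: "'a::real_normed_vector \<Rightarrow> real"
  assumes "smooth_on S g" "p + s *\<^sub>R v \<in> S"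
  shows "((\<lambda>s. g (p + s *\<^sub>R v)) has_derivative (\<lambda>r. r * dir_deriv g (p + s *\<^sub>R v) v)) (at s)"
proof -
  have "((\<lambda>s. p + s *\<^sub>R v) has_derivative (\<lambda>r. r *\<^sub>R v)) (at s)"
    by (auto intro!: derivative_eq_intros)
  from has_derivative_compose[OF this smooth_on_has_derivative[OF assms]]
  show ?thesis
    using has_derivative_bounded_linear[OF smooth_on_has_derivative[OF assms]]
    by (simp add: linear_simps)
qed

text \<open>Two mean value steps, along v for the difference of two parallel edges and then along w.
  The second difference is symmetric in v and w, so exchanging them compares the two mixed
  derivatives.\<close>

lemma second_difference_mvt:
  fixes g :: "'a::real_normed_vector \<Rightarrow> real"
  assumes g: "smooth_on S g" and t: "t > 0"
    and sub: "\<And>a b. 0 \<le> a \<Longrightarrow> a \<le> t \<Longrightarrow> 0 \<le> b \<Longrightarrow> b \<le> t \<Longrightarrow> p + a *\<^sub>R v + b *\<^sub>R w \<in> S"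
  obtains a b where "0 \<le> a" "a \<le> t" "0 \<le> b" "b \<le> t"
    "g (p + t *\<^sub>R v + t *\<^sub>R w) - g (p + t *\<^sub>R v) - g (p + t *\<^sub>R w) + g p
      = t * t * dir_deriv (\<lambda>q. dir_deriv g q v) (p + a *\<^sub>R v + b *\<^sub>R w) w"
proof -
  define h where "h s = g ((p + t *\<^sub>R w) + s *\<^sub>R v) - g (p + s *\<^sub>R v)" for s
  have sub': "(p + b *\<^sub>R w) + a *\<^sub>R v \<in> S" if "0 \<le> a" "a \<le> t" "0 \<le> b" "b \<le> t" for a b
    using sub[OF that] by (simp only: add.assoc add.commute[of "a *\<^sub>R v"])
  have h: "(h has_derivative (\<lambda>r. r * dir_deriv g ((p + t *\<^sub>R w) + s *\<^sub>R v) v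
      - r * dir_deriv g (p + s *\<^sub>R v) v)) (at s within {0..t})"
    if "0 \<le> s" "s \<le> t" for s
    unfolding h_def
    by (rule has_derivative_at_withinI[OF has_derivative_diff[OF
          smooth_on_has_derivative_line[OF g] smooth_on_has_derivative_line[OF g]]])
       (use sub'[OF that, of t] sub'[OF that, of 0] t in simp_all)
  from mvt_simple[OF t h] obtain a where a: "0 < a" "a < t" "h t - h 0 =
     t * dir_deriv g ((p + t *\<^sub>R w) + a *\<^sub>R v) v - t * dir_deriv g (p + a *\<^sub>R v) v"
    by auto
  define k where "k s = dir_deriv g ((p + a *\<^sub>R v) + s *\<^sub>R w) v" for s
  have k: "(k has_derivative (\<lambda>r. r * dir_deriv (\<lambda>q. dir_deriv g q v) ((p + a *\<^sub>R v) + s *\<^sub>R w) w))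
      (at s within {0..t})"
    if "0 \<le> s" "s \<le> t" for s
    unfolding k_def
    by (rule has_derivative_at_withinI[OF smooth_on_has_derivative_line[OF smooth_on_dir_deriv[OF g]]])
       (use sub[OF _ _ that, of a] a in simp_all)
  from mvt_simple[OF t k] obtain b where b: "0 < b" "b < t" "k t - k 0 =
     t * dir_deriv (\<lambda>q. dir_deriv g q v) ((p + a *\<^sub>R v) + b *\<^sub>R w) w"
    by auto
  have "h t - h 0 = t * (k t - k 0)"
    unfolding a k_def by (simp add: algebra_simps)
  also have "\<dots> = t * t * dir_deriv (\<lambda>q. dir_deriv g q v) (p + a *\<^sub>R v + b *\<^sub>R w) w"
    unfolding b by simp
  finally show ?thesis
    using a b by (intro that[of a b]) (simp_all add: h_def algebra_simps)
qed

lemma dir_deriv_commute_real: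
  fixes g :: "'a::real_normed_vector \<Rightarrow> real"
  assumes "open S" "smooth_on S g" "p \<in> S"
  shows "dir_deriv (\<lambda>q. dir_deriv g q v) p w = dir_deriv (\<lambda>q. dir_deriv g q w) p v"
proof -
  define A where "A = (\<lambda>q. dir_deriv (\<lambda>q. dir_deriv g q v) q w)"
  define B where "B = (\<lambda>q. dir_deriv (\<lambda>q. dir_deriv g q w) q v)"
  have "smooth_on S A" "smooth_on S B"
    unfolding A_def B_def by (intro smooth_on_dir_deriv assms)+
  note D = smooth_on_has_derivative[OF this(1) assms(3)] smooth_on_has_derivative[OF this(2) assms(3)]
  have A: "isCont A p" and B: "isCont B p"
    using D[THEN has_derivative_continuous] by auto
  have "\<bar>A p - B p\<bar> \<le> e" if "e > 0" for e
  proof -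
    obtain r1 where r1: "r1 > 0" "\<And>q. dist q p < r1 \<Longrightarrow> dist (A q) (A p) < e/2"
      using A[unfolded continuous_at_eps_delta, THEN spec, of "e/2", THEN mp, OF half_gt_zero[OF \<open>e > 0\<close>]] by blast
    obtain r2 where r2: "r2 > 0" "\<And>q. dist q p < r2 \<Longrightarrow> dist (B q) (B p) < e/2"
      using B[unfolded continuous_at_eps_delta, THEN spec, of "e/2", THEN mp, OF half_gt_zero[OF \<open>e > 0\<close>]] by blast
    obtain r3 where r3: "r3 > 0" "ball p r3 \<subseteq> S"
      using openE[OF assms(1,3)] by blast
    define r where "r = Min {r1, r2, r3}"
    have r: "r > 0" "r \<le> r1" "r \<le> r2" "r \<le> r3" using r1 r2 r3 by (auto simp: r_def)
    \<comment> \<open>The parallelogram with sides t v and t w then lies in the open ball of radius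
      r around p; the summand 1 keeps the denominator positive and the estimate strict.\<close>
    define t where "t = r / (norm v + norm w + 1)"
    have t: "t > 0" using r by (simp add: t_def add_nonneg_pos)
    have close: "dist (p + a *\<^sub>R v + b *\<^sub>R w) p < r" if "0 \<le> a" "a \<le> t" "0 \<le> b" "b \<le> t" for a b
    proof -
      have "norm (a *\<^sub>R v + b *\<^sub>R w) \<le> t * norm v + t * norm w"
        by (rule order_trans[OF norm_triangle_ineq]) (use that in \<open>auto intro!: add_mono mult_right_mono\<close>)
      also have "\<dots> < t * (norm v + norm w + 1)" using t by (simp add: algebra_simps)
      also have "\<dots> = r" using norm_ge_zero[of v] norm_ge_zero[of w] by (simp add: t_def add_nonneg_eq_0_iff)
      finally show ?thesis by (simp add: dist_norm)
    qed
    have sub: "p + a *\<^sub>R v + b *\<^sub>R w \<in> S" if "0 \<le> a" "a \<le> t" "0 \<le> b" "b \<le> t" for a b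
      using close[OF that] r r3 by (auto simp: dist_commute subset_iff)
    have sub': "p + a *\<^sub>R w + b *\<^sub>R v \<in> S" if "0 \<le> a" "a \<le> t" "0 \<le> b" "b \<le> t" for a b
      using sub[of b a] that by (simp add: algebra_simps)
    obtain a b where ab: "0 \<le> a" "a \<le> t" "0 \<le> b" "b \<le> t"
      "g (p + t *\<^sub>R v + t *\<^sub>R w) - g (p + t *\<^sub>R v) - g (p + t *\<^sub>R w) + g p = t * t * A (p + a *\<^sub>R v + b *\<^sub>R w)"
      unfolding A_def by (rule second_difference_mvt[OF assms(2) t sub])
    obtain c d where cd: "0 \<le> c" "c \<le> t" "0 \<le> d" "d \<le> t"
      "g (p + t *\<^sub>R w + t *\<^sub>R v) - g (p + t *\<^sub>R w) - g (p + t *\<^sub>R v) + g p = t * t * B (p + c *\<^sub>R w + d *\<^sub>R v)"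
      unfolding B_def by (rule second_difference_mvt[OF assms(2) t sub'])
    \<comment> \<open>Both sides are the same second difference, so the mixed derivatives agree at
      two points near p that are in general different; continuity brings both to p.\<close>
    have "t * t * A (p + a *\<^sub>R v + b *\<^sub>R w) = t * t * B (p + d *\<^sub>R v + c *\<^sub>R w)"
      using ab(5) cd(5) by (simp add: algebra_simps)
    then have "A (p + a *\<^sub>R v + b *\<^sub>R w) = B (p + d *\<^sub>R v + c *\<^sub>R w)" using t by simp
    moreover have "dist (A (p + a *\<^sub>R v + b *\<^sub>R w)) (A p) < e/2"
      using close[OF ab(1-4)] r by (intro r1) auto
    moreover have "dist (B (p + d *\<^sub>R v + c *\<^sub>R w)) (B p) < e/2"
      using close[OF cd(3,4,1,2)] r by (intro r2) auto
    ultimately show ?thesis unfolding dist_real_def by linarith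
  qed
  then have "\<bar>A p - B p\<bar> \<le> 0" by (rule field_le_epsilon) simp
  then show ?thesis by (simp add: A_def B_def)
qed

lemma dir_deriv_commute:
  fixes g :: "'a::real_normed_vector \<Rightarrow> 'b::euclidean_space"
  assumes "open S" "smooth_on S g" "p \<in> S"
  shows "dir_deriv (\<lambda>q. dir_deriv g q v) p w = dir_deriv (\<lambda>q. dir_deriv g q w) p v"
proof (rule euclidean_eqI)
  fix e :: 'b
  have L: "bounded_linear (\<lambda>x. x \<bullet> e)" by (rule bounded_linear_inner_left)
  have in1: "dir_deriv (\<lambda>q. h q \<bullet> e) q x = dir_deriv h q x \<bullet> e" if "smooth_on S h" "q \<in> S" for h :: "'a \<Rightarrow> 'b" and q x
    by (rule dir_deriv_eq) (rule bounded_linear.has_derivative[OF L smooth_on_has_derivative[OF that]])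
  have "dir_deriv (\<lambda>q. dir_deriv g q x) p y \<bullet> e = dir_deriv (\<lambda>q. dir_deriv (\<lambda>q. g q \<bullet> e) q x) p y" for x y
  proof -
    have "dir_deriv (\<lambda>q. dir_deriv g q x) p y \<bullet> e = dir_deriv (\<lambda>q. dir_deriv g q x \<bullet> e) p y"
      using in1[OF smooth_on_dir_deriv[OF assms(2)] assms(3)] by simp
    also have "\<dots> = dir_deriv (\<lambda>q. dir_deriv (\<lambda>q. g q \<bullet> e) q x) p y"
      by (rule dir_deriv_cong_open[OF assms(1,3)]) (simp add: in1 assms)
    finally show ?thesis .
  qed
  then show "dir_deriv (\<lambda>q. dir_deriv g q v) p w \<bullet> e = dir_deriv (\<lambda>q. dir_deriv g q w) p v \<bullet> e"
    using dir_deriv_commute_real[OF assms(1) smooth_on_linear[OF L assms(1,2)] assms(3)] by simp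
qed

section \<open>Bilinear algebra\<close>

lemma bilinear_bil: "bilinear bil"
  unfolding bilinear_def
  by (auto intro!: linearI simp: bil_def sum.distrib sum_distrib_left algebra_simps scaleR_conv_of_real[where 'a=complex])

text \<open>\<open>bounded_bilinear\<close> speaks of real scalars and serves the product rule;
  complex scalars are moved by \<open>bil_smult_left\<close> and
  \<open>bil_smult_right\<close>.\<close>

interpretation bil: bounded_bilinear bil
  using bilinear_bil by (simp add: bilinear_conv_bounded_bilinear)

lemma linear_conjv: "linear conjv"
  by (auto intro!: linearI simp: conjv_def vec_eq_iff)

lemma bounded_linear_conjv: "bounded_linear conjv"
  using linear_conjv by (simp add: linear_conv_bounded_linear)

lemma bilinear_hopf_diff: "bilinear hopf_diff"
  unfolding bilinear_def
  by (auto intro!: linearI simp: hopf_diff_def vec_eq_iff algebra_simps)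

interpretation hopf: bounded_bilinear hopf_diff
  using bilinear_hopf_diff by (simp add: bilinear_conv_bounded_bilinear)

lemma bilinear_matrix_mult: "bilinear ((**) :: complex^4^4 \<Rightarrow> complex^4^4 \<Rightarrow> complex^4^4)"
  unfolding bilinear_def
  by (auto intro!: linearI simp: matrix_matrix_mult_def vec_eq_iff sum.distrib sum_distrib_left algebra_simps
        scaleR_conv_of_real[where 'a=complex])

interpretation mm: bounded_bilinear "(**) :: complex^4^4 \<Rightarrow> complex^4^4 \<Rightarrow> complex^4^4"
  using bilinear_matrix_mult by (simp add: bilinear_conv_bounded_bilinear)

lemma bounded_linear_transpose: "bounded_linear (transpose :: complex^4^4 \<Rightarrow> complex^4^4)"
  unfolding linear_conv_bounded_linear[symmetric]
  by (auto intro!: linearI simp: transpose_def vec_eq_iff)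

lemma bilinear_smult: "bilinear ((*s) :: complex \<Rightarrow> complex^4 \<Rightarrow> complex^4)"
  unfolding bilinear_def
  by (auto intro!: linearI simp: vec_eq_iff algebra_simps scaleR_conv_of_real[where 'a=complex])

interpretation sm: bounded_bilinear "(*s) :: complex \<Rightarrow> complex^4 \<Rightarrow> complex^4"
  using bilinear_smult by (simp add: bilinear_conv_bounded_bilinear)

lemma bil_commute: "bil v w = bil w v"
  by (simp add: bil_def mult.commute)

lemma bil_smult_left [simp]: "bil (c *s v) w = c * bil v w"
  and bil_smult_right [simp]: "bil v (c *s w) = c * bil v w"
  by (simp_all add: bil_def sum_distrib_left algebra_simps)

lemma conjv_conjv [simp]: "conjv (conjv v) = v"
  by (simp add: conjv_def vec_eq_iff)

lemma conjv_smult [simp]: "conjv (c *s v) = cnj c *s conjv v"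
  by (simp add: conjv_def vec_eq_iff)

lemma cnj_bil: "cnj (bil v w) = bil (conjv v) (conjv w)"
  by (simp add: bil_def conjv_def)

lemma cnj_bil_conjv: "cnj (bil v (conjv w)) = bil w (conjv v)"
  by (simp add: cnj_bil bil_commute)

lemma scaleR_smult: "r *\<^sub>R v = complex_of_real r *s v" for v :: "complex^4"
  by (simp add: vec_eq_iff scaleR_conv_of_real[where 'a=complex])

lemma bil_conjv_self: "bil v (conjv v) = of_real ((norm v)\<^sup>2)"
  unfolding power2_norm_C4 by (simp add: bil_def conjv_def)

lemma inner_eq_bil: "v \<bullet> w = Re (bil v (conjv w))"
  by (simp add: inner_vec_def bil_def conjv_def inner_complex_def)

text \<open>All four vectors are arbitrary because differentiating
  \<open>hopf_diff (F q) (dir_deriv F q w)\<close> produces a term whose base vector is a derivative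
  of F instead of F.\<close>

lemma fs_metric_hopf_diff:
  "fs_metric (hopf_diff a b) (hopf_diff p w) =
    Re (bil b (conjv w) * bil p (conjv a) + bil b (conjv p) * bil w (conjv a)
      + bil a (conjv w) * bil p (conjv b) + bil a (conjv p) * bil w (conjv b)) / 2"
proof -
  have ip: "X \<bullet> Y = Re (\<Sum>j\<in>UNIV. \<Sum>k\<in>UNIV. X $ j $ k * cnj (Y $ j $ k))" for X Y :: "complex^4^4"
    by (simp add: inner_vec_def inner_complex_def)
  show ?thesis
    unfolding fs_metric_def ip
    by (rule arg_cong[where f="\<lambda>x. Re x / 2"])
      (simp add: hopf_diff_def bil_def conjv_def sum_4 algebra_simps)
qed

lemma bilinear_fs_metric: "bounded_bilinear fs_metric"
proof -
  have "bounded_bilinear (\<lambda>X Y :: complex^4^4. X \<bullet> (1/2) *\<^sub>R Y)"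
    by (rule bounded_bilinear.comp[OF bounded_bilinear_inner bounded_linear_ident bounded_linear_scaleR_right])
  then show ?thesis by (simp add: fs_metric_def[abs_def])
qed

interpretation fs: bounded_bilinear fs_metric
  by (rule bilinear_fs_metric)

text \<open>Two candidates differ by an element of W that is orthogonal to itself; closure under
  differences makes this element an admissible test vector.\<close>

lemma orth_proj_eq:
  assumes "Y \<in> W" "\<And>Z. Z \<in> W \<Longrightarrow> fs_metric (X - Y) Z = 0"
    and diff: "\<And>A B. A \<in> W \<Longrightarrow> B \<in> W \<Longrightarrow> A - B \<in> W"
  shows "orth_proj W X = Y"
  unfolding orth_proj_def
proof (rule the_equality)
  show "Y \<in> W \<and> (\<forall>Z\<in>W. fs_metric (X - Y) Z = 0)" using assms by auto
  fix V assume V: "V \<in> W \<and> (\<forall>Z\<in>W. fs_metric (X - V) Z = 0)"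
  then have "fs_metric (X - Y) (Y - V) = 0" "fs_metric (X - V) (Y - V) = 0"
    using assms by auto
  then have "fs_metric (Y - V) (Y - V) = 0"
    by (simp add: fs.diff_left)
  then show "V = Y" by (simp add: fs_metric_def)
qed

section \<open>The tangent spaces of the quadric\<close>

text \<open>\<open>bil w p = 0\<close> is the linearised equation of the quadric,
  \<open>bil w (conjv p) = 0\<close> is horizontality for the Hopf map. The pair of conditions is
  invariant under conjugation, so bilinear and Hermitian products can be exchanged on this
  space.\<close>

definition horizontal_space :: "complex^4 \<Rightarrow> (complex^4) set" where
  "horizontal_space p = {w. bil w p = 0 \<and> bil w (conjv p) = 0}"

text \<open>For a unit vector p with \<open>bil p p = 0\<close> the vectors p and
  \<open>conjv p\<close> are Hermitian orthonormal, and this is the Hermitian orthogonal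
  projection.\<close>

definition horizontal_proj :: "complex^4 \<Rightarrow> complex^4 \<Rightarrow> complex^4" where
  "horizontal_proj p w = w - bil w (conjv p) *s p - bil w p *s conjv p"

lemma proj_pt_nth: "norm p = 1 \<Longrightarrow> proj_pt p $ j $ k = p $ j * cnj (p $ k)"
  by (simp add: proj_pt_def)

lemma proj_pt_normalize:
  assumes "z \<noteq> 0" shows "proj_pt ((1 / of_real (norm z)) *s z) = proj_pt z"
    "norm ((1 / complex_of_real (norm z)) *s z) = 1"
proof -
  have "(1 / complex_of_real (norm z)) *s z = (1 / norm z) *\<^sub>R z" by (simp add: scaleR_smult)
  then show n: "norm ((1 / complex_of_real (norm z)) *s z) = 1" using assms by simp
  show "proj_pt ((1 / of_real (norm z)) *s z) = proj_pt z"
    unfolding vec_eq_iff proj_pt_nth[OF n] by (simp add: proj_pt_def power2_eq_square)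
qed

lemma Q2_cases:
  assumes "Q \<in> Q2" obtains p where "norm p = 1" "bil p p = 0" "Q = proj_pt p"
  using assms proj_pt_normalize unfolding Q2_def
  by (smt (verit) bil_smult_left bil_smult_right mem_Collect_eq mult_zero_right)

lemma sum_cnj_mult_self: "norm p = 1 \<Longrightarrow> (\<Sum>k\<in>UNIV. cnj (p $ k) * p $ k) = 1" for p :: "complex^4"
  using bil_conjv_self[of p] by (simp add: bil_def conjv_def mult.commute)

lemma proj_pt_idem: "norm p = 1 \<Longrightarrow> proj_pt p ** proj_pt p = proj_pt p"
proof -
  assume p: "norm p = 1"
  have "(\<Sum>l\<in>UNIV. p $ j * cnj (p $ l) * (p $ l * cnj (p $ k)))
    = p $ j * cnj (p $ k) * (\<Sum>l\<in>UNIV. cnj (p $ l) * p $ l)" for j k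
    by (simp add: sum_distrib_left algebra_simps)
  then show ?thesis
    by (simp add: vec_eq_iff matrix_matrix_mult_def proj_pt_nth p sum_cnj_mult_self)
qed

text \<open>Turns the equation of the quadric into P P^T = 0, which does not depend on the
  representative of the point and can be differentiated along curves.\<close>

lemma proj_pt_mult_transpose:
  "norm p = 1 \<Longrightarrow> (proj_pt p ** transpose (proj_pt p)) $ j $ k = p $ j * p $ k * cnj (bil p p)"
  by (simp add: matrix_matrix_mult_def transpose_def proj_pt_nth bil_def sum_distrib_left algebra_simps)

lemma bil_self_eq_0_if_Q2:
  assumes "norm p = 1" "proj_pt p \<in> Q2" shows "bil p p = 0"
proof -
  obtain q where q: "norm q = 1" "bil q q = 0" "proj_pt p = proj_pt q"
    using assms Q2_cases by metis
  have "proj_pt p ** transpose (proj_pt p) = 0"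
    unfolding q(3) vec_eq_iff proj_pt_mult_transpose[OF q(1)] by (simp add: q(2))
  then have "p $ j * p $ k * cnj (bil p p) = 0" for j k
    using proj_pt_mult_transpose[OF assms(1), of j k] by simp
  moreover obtain j where "p $ j \<noteq> 0"
    using assms(1) by (metis norm_zero vec_eq_iff zero_index zero_neq_one)
  ultimately show ?thesis by (metis complex_cnj_zero_iff mult_eq_0_iff)
qed

definition adjm :: "complex^4^4 \<Rightarrow> complex^4^4" where
  "adjm A = (\<chi> j k. cnj (A $ k $ j))"

lemma bounded_linear_adjm: "bounded_linear adjm"
  unfolding linear_conv_bounded_linear[symmetric]
  by (auto intro!: linearI simp: adjm_def vec_eq_iff)

text \<open>A curve in the quadric satisfies P P = P, P P^T = 0 and P = P^H identically. The
  derivatives of the first and third equation make X a Hopf differential in a horizontal direction;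
  the second makes that direction tangent to the null cone.\<close>

lemma tangent_space_Q2_subset:
  assumes p: "norm p = 1" "bil p p = 0" and X: "X \<in> tangent_space Q2 (proj_pt p)"
  shows "X \<in> hopf_diff p ` horizontal_space p"
proof -
  let ?P = "proj_pt p"
  obtain \<epsilon> c where e: "\<epsilon> > 0" and cQ: "\<And>t. t \<in> {-\<epsilon><..<\<epsilon>} \<Longrightarrow> c t \<in> Q2" and c0: "c 0 = ?P"
    and c: "(c has_vector_derivative X) (at 0)"
    using X unfolding tangent_space_def by blast
  have U: "A = B" if "(g has_vector_derivative A) (at 0)" "(h has_vector_derivative B) (at 0)"
    "\<And>Q. Q \<in> Q2 \<Longrightarrow> G Q = H Q" "g = (\<lambda>t. G (c t))" "h = (\<lambda>t. H (c t))"
    for g h :: "real \<Rightarrow> complex^4^4" and A B and G H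
  proof (rule vector_derivative_unique_at)
    show "(g has_vector_derivative A) (at 0)" by fact
    show "(g has_vector_derivative B) (at 0)"
      by (rule has_vector_derivative_transform_within_open[OF that(2), of "{-\<epsilon><..<\<epsilon>}"])
        (use e cQ that in auto)
  qed
  note c' = c[unfolded has_vector_derivative_def]
  have dc: "((\<lambda>t. c t ** c t) has_vector_derivative (?P ** X + X ** ?P)) (at 0)"
    using mm.FDERIV[OF c' c'] by (simp add: has_vector_derivative_def c0 mm.scaleR_left mm.scaleR_right scaleR_right_distrib)
  have dt: "((\<lambda>t. c t ** transpose (c t)) has_vector_derivative (?P ** transpose X + X ** transpose ?P)) (at 0)"
    using mm.FDERIV[OF c' bounded_linear.has_derivative[OF bounded_linear_transpose c']]
    by (simp add: has_vector_derivative_def c0 mm.scaleR_left mm.scaleR_right scaleR_right_distrib linear_simps[OF bounded_linear_transpose])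
  have da: "((\<lambda>t. adjm (c t)) has_vector_derivative adjm X) (at 0)"
    using bounded_linear.has_derivative[OF bounded_linear_adjm c'] by (simp add: has_vector_derivative_def linear_simps[OF bounded_linear_adjm])
  have 1: "?P ** X + X ** ?P = X"
    by (rule U[OF dc c, of "\<lambda>Q. Q ** Q" "\<lambda>Q. Q"]) (auto elim!: Q2_cases simp: proj_pt_idem)
  have 2: "?P ** transpose X + X ** transpose ?P = 0"
    by (rule U[OF dt has_vector_derivative_const[of 0], of "\<lambda>Q. Q ** transpose Q" "\<lambda>Q. 0"])
      (auto elim!: Q2_cases simp: vec_eq_iff proj_pt_mult_transpose)
  have 3: "adjm X = X"
    by (rule U[OF da c, of "\<lambda>Q. adjm Q" "\<lambda>Q. Q"]) (auto elim!: Q2_cases simp: vec_eq_iff adjm_def proj_pt_nth)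
  have herm: "cnj (X $ k $ j) = X $ j $ k" for j k
    using 3 by (simp add: vec_eq_iff adjm_def)
  \<comment> \<open>As X is Hermitian, P X + X P = X reads X = w p^H + p w^H with w = X p.\<close>
  define w where "w = (\<chi> j. \<Sum>k\<in>UNIV. X $ j $ k * p $ k)"
  have XP: "(X ** ?P) $ j $ k = w $ j * cnj (p $ k)" for j k
    by (simp add: matrix_matrix_mult_def proj_pt_nth p w_def sum_distrib_left sum_distrib_right algebra_simps)
  have PX: "(?P ** X) $ j $ k = p $ j * cnj (w $ k)" for j k
    by (simp add: matrix_matrix_mult_def proj_pt_nth p w_def sum_distrib_left sum_distrib_right algebra_simps herm)
  have X: "X = hopf_diff p w"
  proof -
    have "X $ j $ k = (?P ** X + X ** ?P) $ j $ k" for j k using 1 by simp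
    also have "\<dots> j k = hopf_diff p w $ j $ k" for j k by (simp add: XP PX hopf_diff_def)
    finally show ?thesis by (simp add: vec_eq_iff)
  qed
  obtain i where i: "p $ i \<noteq> 0"
    using p(1) by (metis norm_zero vec_eq_iff zero_index zero_neq_one)
  \<comment> \<open>Apply X = \<open>hopf_diff p w\<close> to p once more: since |p| = 1 the second
    summand has to vanish, which is horizontality of w.\<close>
  have "w $ j = w $ j * bil p (conjv p) + p $ j * bil p (conjv w)" for j
  proof -
    have "w $ j = (\<Sum>k\<in>UNIV. hopf_diff p w $ j $ k * p $ k)" using X by (simp add: w_def)
    also have "\<dots> = w $ j * bil p (conjv p) + p $ j * bil p (conjv w)"
      by (simp add: hopf_diff_def bil_def conjv_def sum.distrib sum_distrib_left algebra_simps)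
    finally show ?thesis .
  qed
  from this[of i] have "bil p (conjv w) = 0" using i by (simp add: bil_conjv_self p)
  then have w1: "bil w (conjv p) = 0"
    using cnj_bil_conjv[of p w] by simp
  have "(X ** transpose ?P) $ j $ k = p $ j * p $ k * cnj (bil p w) + w $ j * p $ k * cnj (bil p p)" for j k
    unfolding X
    by (simp add: matrix_matrix_mult_def transpose_def hopf_diff_def proj_pt_nth p(1) bil_def sum.distrib
        sum_distrib_left algebra_simps)
  moreover have "(?P ** transpose X) $ j $ k = (X ** transpose ?P) $ k $ j" for j k
    by (simp add: matrix_matrix_mult_def transpose_def mult.commute)
  ultimately have "(?P ** transpose X + X ** transpose ?P) $ i $ i = 2 * (p $ i * p $ i * cnj (bil p w))"
    using p by simp
  then have "bil p w = 0" using 2 i by simp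
  then have "w \<in> horizontal_space p" using w1 by (simp add: horizontal_space_def bil_commute)
  with X show ?thesis by blast
qed

lemma smooth_on_proj_pt:
  assumes "open S" "smooth_on S z" "\<And>t. t \<in> S \<Longrightarrow> z t \<noteq> 0"
  shows "smooth_on S (\<lambda>t. proj_pt (z t))"
proof -
  have z: "Ck_on k S z" for k using assms by (simp add: smooth_on_def)
  have n: "Ck_on k S (\<lambda>t. inverse (z t \<bullet> z t))" for k
    by (rule Ck_on_inverse[OF assms(1) _ Ck_on_bilinear[OF assms(1) bounded_bilinear_inner z z]])
      (use assms(3) in simp)
  have m: "Ck_on k S (\<lambda>t. z t $ i * cnj (z t $ j))" for k i j
    by (rule Ck_on_bilinear[OF assms(1) bounded_bilinear_mult Ck_on_nth[OF assms(1) z]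
          Ck_on_linear[OF assms(1) bounded_linear_cnj Ck_on_nth[OF assms(1) z]]])
  have "Ck_on k S (\<lambda>t. inverse (z t \<bullet> z t) *\<^sub>R (\<chi> i j. z t $ i * cnj (z t $ j)))" for k
    by (rule Ck_on_bilinear[OF assms(1) bounded_bilinear_scaleR n Ck_on_vec[OF assms(1) Ck_on_vec[OF assms(1) m]]])
  moreover have "(\<lambda>t. inverse (z t \<bullet> z t) *\<^sub>R (\<chi> i j. z t $ i * cnj (z t $ j))) = (\<lambda>t. proj_pt (z t))"
    by (simp add: fun_eq_iff vec_eq_iff proj_pt_def dot_square_norm scaleR_conv_of_real[where 'a=complex] divide_inverse mult.commute)
  ultimately show ?thesis by (simp add: smooth_on_def)
qed

lemma tangent_space_Q2_supset:
  assumes p: "norm p = 1" "bil p p = 0" and w: "w \<in> horizontal_space p"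
  shows "hopf_diff p w \<in> tangent_space Q2 (proj_pt p)"
proof -
  \<comment> \<open>The quadratic correction keeps the curve on the null cone for every t, not only
    to first order: since \<open>bil p (conjv p) = 1\<close>, twice its product with p cancels t^2
    \<open>bil w w\<close>.\<close>
  define z where "z t = p + t *\<^sub>R w + (t * t) *\<^sub>R ((- (bil w w) / 2) *s conjv p)" for t :: real
  have w': "bil w p = 0" "bil w (conjv p) = 0" "bil p w = 0" "bil (conjv p) w = 0"
    using w by (simp_all add: horizontal_space_def bil_commute)
  have pp: "bil p (conjv p) = 1" "bil (conjv p) p = 1" "bil (conjv p) (conjv p) = 0"
    using p bil_conjv_self[of p] cnj_bil[of p p] by (simp_all add: bil_commute)
  have z0: "bil (z t) (z t) = 0" for t
    by (simp add: z_def bil.add_left bil.add_right bil.diff_left bil.diff_right bil.scaleR_left bil.scaleR_right w' pp p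
        scaleR_conv_of_real[where 'a=complex])
  have "bil (z t) (conjv p) = 1" for t
    by (simp add: z_def bil.add_left bil.diff_left bil.scaleR_left w' pp)
  then have z1: "z t \<noteq> 0" for t by (metis bil.zero_left zero_neq_one)
  have D: "(z has_derivative (\<lambda>s. s *\<^sub>R w)) (at 0)"
    unfolding z_def by (auto intro!: derivative_eq_intros)
  have "((\<lambda>t. proj_pt (z t)) has_derivative (\<lambda>s. hopf_diff p (s *\<^sub>R w) - (2 * (p \<bullet> s *\<^sub>R w)) *\<^sub>R proj_pt p)) (at 0)"
    by (rule has_derivative_compose[OF D]) (use has_derivative_proj_pt[OF p(1)] in \<open>simp add: z_def\<close>)
  moreover have "p \<bullet> w = 0" by (subst inner_commute) (simp add: inner_eq_bil w')
  ultimately have D': "((\<lambda>t. proj_pt (z t)) has_vector_derivative hopf_diff p w) (at 0)"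
    by (simp add: has_vector_derivative_def hopf.scaleR_right)
  have S: "smooth_on {-1<..<1} (\<lambda>t. proj_pt (z t))"
  proof (rule smooth_on_proj_pt)
    have o: "open {-1<..<1::real}" by simp
    note lin = Ck_on_linear[OF o bounded_linear_scaleR_left]
    have "Ck_on k {-1<..<1} z" for k
      unfolding z_def
      by (intro Ck_on_add[OF o Ck_on_add[OF o Ck_on_const[OF o] lin[OF Ck_on_id[OF o]]]
         lin[OF Ck_on_bilinear[OF o bounded_bilinear_mult Ck_on_id[OF o] Ck_on_id[OF o]]]])
    then show "smooth_on {-1<..<1} z" by (simp add: smooth_on_def)
  qed (auto simp: z1)
  show ?thesis
    unfolding tangent_space_def
    by (rule CollectI, rule exI[of _ 1], intro conjI exI[of _ "\<lambda>t. proj_pt (z t)"])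
       (use S D' z0 z1 in \<open>auto simp: Q2_def z_def[of 0]\<close>)
qed

lemma tangent_space_Q2:
  "norm p = 1 \<Longrightarrow> bil p p = 0 \<Longrightarrow> tangent_space Q2 (proj_pt p) = hopf_diff p ` horizontal_space p"
  using tangent_space_Q2_subset tangent_space_Q2_supset by blast

section \<open>Horizontal projection and inner products of Hopf differentials\<close>

lemma horizontal_proj_mem:
  assumes "norm p = 1" "bil p p = 0"
  shows "horizontal_proj p w \<in> horizontal_space p"
proof -
  have "bil p (conjv p) = 1" "bil (conjv p) p = 1" "bil (conjv p) (conjv p) = 0"
    using assms bil_conjv_self[of p] cnj_bil[of p p] by (simp_all add: bil_commute)
  then show ?thesis
    using assms by (simp add: horizontal_space_def horizontal_proj_def bil.diff_left)
qed

lemma horizontal_space_diff: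
  "v \<in> horizontal_space p \<Longrightarrow> w \<in> horizontal_space p \<Longrightarrow> v - w \<in> horizontal_space p"
  by (simp add: horizontal_space_def bil.diff_left)

lemma horizontal_space_scaleR: "w \<in> horizontal_space q \<Longrightarrow> r *\<^sub>R w \<in> horizontal_space q"
  and horizontal_space_add: "w \<in> horizontal_space q \<Longrightarrow> v \<in> horizontal_space q \<Longrightarrow> v + w \<in> horizontal_space q"
  by (simp_all add: horizontal_space_def bil.scaleR_left bil.add_left)

lemma horizontal_space_conjv: "w \<in> horizontal_space p \<Longrightarrow> conjv w \<in> horizontal_space p"
  using cnj_bil[of w p] cnj_bil[of w "conjv p"] by (auto simp: horizontal_space_def)

lemma bil_horizontal_proj: 
  "v \<in> horizontal_space p \<Longrightarrow> bil (horizontal_proj p w) v = bil w v"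
  by (simp add: horizontal_space_def horizontal_proj_def bil.diff_right bil_commute[of _ v])

text \<open>One horizontal argument already removes the mixed terms, so v may be a second derivative
  of the lift, which is in general not horizontal.\<close>

lemma fs_metric_hopf_diff_horizontal:
  assumes "norm p = 1" "w \<in> horizontal_space p"
  shows "fs_metric (hopf_diff p v) (hopf_diff p w) = Re (bil v (conjv w))"
proof -
  have "bil p (conjv w) = 0"
    using assms(2) cnj_bil_conjv[of w p] by (simp add: horizontal_space_def)
  then show ?thesis
    using assms by (simp add: fs_metric_hopf_diff horizontal_space_def bil_conjv_self
        cnj_bil_conjv[of v w, symmetric])
qed

text \<open>Every term contains a product of a or b with p or its conjugate. Such matrices are the
  part of the second derivative of f that the Levi-Civita connection of the quadric
  discards.\<close>

lemma fs_metric_hopf_diff_vertical: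
  assumes "a \<in> horizontal_space p" "b \<in> horizontal_space p"
  shows "fs_metric (hopf_diff a b) (hopf_diff p w) = 0"
proof -
  have "bil p (conjv a) = 0" "bil p (conjv b) = 0"
    using assms cnj_bil_conjv[of a p] cnj_bil_conjv[of b p] by (auto simp: horizontal_space_def)
  then show ?thesis
    using assms by (simp add: fs_metric_hopf_diff horizontal_space_def)
qed

lemma hopf_diff_eq_0_iff:
  assumes "norm p = 1" "w \<in> horizontal_space p"
  shows "hopf_diff p w = 0 \<longleftrightarrow> w = 0"
proof
  assume "hopf_diff p w = 0"
  then have "Re (bil w (conjv w)) = 0"
    using fs_metric_hopf_diff_horizontal[OF assms, of w] by (simp add: fs.zero_left)
  then show "w = 0" by (simp add: bil_conjv_self)
qed (simp add: hopf.zero_right)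

section \<open>Lagrangian surfaces and their horizontal lifts\<close>

lemma dir_deriv_const: "dir_deriv (\<lambda>q. c) p v = 0"
  by (rule dir_deriv_eq) simp

lemma dir_deriv_complex:
  assumes "(g has_derivative dir_deriv g p) (at p)"
  shows "dir_deriv g p v = Re v *\<^sub>R dir_deriv g p 1 + Im v *\<^sub>R dir_deriv g p \<i>"
proof -
  have v: "v = Re v *\<^sub>R 1 + Im v *\<^sub>R \<i>" by (simp add: complex_eq_iff)
  show ?thesis
    using linear_simps(1,5)[OF has_derivative_bounded_linear[OF assms]] by (subst v) simp
qed

lemma dir_deriv_bilinear:
  assumes "bounded_bilinear B" "smooth_on S g" "smooth_on S h" "p \<in> S"
  shows "dir_deriv (\<lambda>q. B (g q) (h q)) p v = B (g p) (dir_deriv h p v) + B (dir_deriv g p v) (h p)"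
  by (rule dir_deriv_eq[OF bounded_bilinear.FDERIV[OF assms(1)
        smooth_on_has_derivative[OF assms(2,4)] smooth_on_has_derivative[OF assms(3,4)]]])

lemma dir_deriv_linear:
  assumes "bounded_linear L" "smooth_on S g" "p \<in> S"
  shows "dir_deriv (\<lambda>q. L (g q)) p v = L (dir_deriv g p v)"
  by (rule dir_deriv_eq[OF bounded_linear.has_derivative[OF assms(1) smooth_on_has_derivative[OF assms(2,3)]]])

lemmas dir_deriv_bil = dir_deriv_bilinear[OF bil.bounded_bilinear_axioms]
lemmas dir_deriv_conjv = dir_deriv_linear[OF bounded_linear_conjv]
lemmas smooth_on_conjv = smooth_on_linear[OF bounded_linear_conjv]
lemmas smooth_on_bil = smooth_on_bilinear[OF bil.bounded_bilinear_axioms]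

abbreviation second_deriv :: "(complex \<Rightarrow> complex^4) \<Rightarrow> complex \<Rightarrow> complex \<Rightarrow> complex \<Rightarrow> complex^4" where
  "second_deriv F p v w \<equiv> dir_deriv (\<lambda>q. dir_deriv F q w) p v"

locale lagrangian_lift =
  fixes D :: "complex set" and f :: "complex \<Rightarrow> complex^4^4"
    and F :: "complex \<Rightarrow> complex^4" and u :: "complex \<Rightarrow> real"
  assumes open_D: "open D" and connected_D: "connected D" and nonempty_D: "D \<noteq> {}"
    and immersion: "immersion_into Q2 D f" and lagrangian: "lagrangian_map D f"
    and metric: "induced_metric_is D f u" and lift: "horizontal_lift D f F"
    and gap: "\<forall>p\<in>D. exp (2 * u p) - (cmod (alpha F p))\<^sup>2 > 0"
begin

lemma smooth_F: "smooth_on D F"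
  using lift by (simp add: horizontal_lift_def)

lemmas smooth_dF = smooth_on_dir_deriv[OF smooth_F]

lemma norm_F: "p \<in> D \<Longrightarrow> norm (F p) = 1"
  using lift by (auto simp: horizontal_lift_def)

lemma f_eq: "p \<in> D \<Longrightarrow> f p = proj_pt (F p)"
  using lift by (simp add: horizontal_lift_def)

lemma bil_F_F: "p \<in> D \<Longrightarrow> bil (F p) (F p) = 0"
  using immersion f_eq norm_F bil_self_eq_0_if_Q2 by (auto simp: immersion_into_def image_subset_iff)

lemma dF_eq:
  "p \<in> D \<Longrightarrow> dir_deriv F p v = Re v *\<^sub>R dir_deriv F p 1 + Im v *\<^sub>R dir_deriv F p \<i>"
  by (rule dir_deriv_complex[OF smooth_on_has_derivative[OF smooth_F]])

lemma dF_horizontal: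
  assumes "p \<in> D" shows "dir_deriv F p v \<in> horizontal_space (F p)"
proof -
  have "dir_deriv (\<lambda>q. bil (F q) (F q)) p v = dir_deriv (\<lambda>q. 0) p v"
    by (rule dir_deriv_cong_open[OF open_D assms]) (rule bil_F_F)
  then have "bil (dir_deriv F p v) (F p) = 0"
    using dir_deriv_bil[OF smooth_F smooth_F assms, of v] bil_commute[of "F p"] by (simp add: dir_deriv_const)
  moreover have "bil (wirt_z F p) (conjv (F p)) = 0" "bil (wirt_zbar F p) (conjv (F p)) = 0"
    using lift assms by (auto simp: horizontal_lift_def)
  then have "bil (dir_deriv F p 1) (conjv (F p)) = 0" "bil (dir_deriv F p \<i>) (conjv (F p)) = 0"
    by (simp_all add: wirt_z_def wirt_zbar_def bil.diff_left bil.add_left)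
  then have "bil (dir_deriv F p v) (conjv (F p)) = 0"
    by (subst dF_eq[OF assms]) (simp add: bil.add_left bil.scaleR_left)
  ultimately show ?thesis by (simp add: horizontal_space_def)
qed

lemma dir_deriv_f:
  assumes "p \<in> D" shows "dir_deriv f p v = hopf_diff (F p) (dir_deriv F p v)"
proof -
  have "dir_deriv f p v = dir_deriv (\<lambda>q. proj_pt (F q)) p v"
    by (rule dir_deriv_cong_open[OF open_D assms]) (rule f_eq)
  also have "\<dots> = hopf_diff (F p) (dir_deriv F p v) - (2 * (F p \<bullet> dir_deriv F p v)) *\<^sub>R proj_pt (F p)"
    by (rule dir_deriv_eq[OF has_derivative_compose[OF smooth_on_has_derivative[OF smooth_F assms]
            has_derivative_proj_pt[OF norm_F[OF assms]]]])
  also have "F p \<bullet> dir_deriv F p v = 0"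
    using dF_horizontal[OF assms, of v] by (subst inner_commute) (simp add: inner_eq_bil horizontal_space_def)
  finally show ?thesis by simp
qed

text \<open>The metric is the real part of the Hermitian product and the Kaehler form, up to sign,
  its imaginary part. The metric and the Lagrangian condition together say that F_x and F_y, divided
  by sqrt(2 exp u), are Hermitian orthonormal.\<close>

lemma bil_dF_conjv_dF:
  assumes "p \<in> D"
  shows "bil (dir_deriv F p v) (conjv (dir_deriv F p w)) = of_real (2 * exp (u p) * (v \<bullet> w))"
proof (rule complex_eqI)
  note n = norm_F[OF assms]
  have h: "bil (dir_deriv F p v) (conjv (F p)) = 0" for v
    using dF_horizontal[OF assms] by (simp add: horizontal_space_def)
  have "fs_metric (dir_deriv f p v) (dir_deriv f p w) = 2 * exp (u p) * (v \<bullet> w)"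
    using metric assms by (simp add: induced_metric_is_def)
  then show "Re (bil (dir_deriv F p v) (conjv (dir_deriv F p w))) = Re (of_real (2 * exp (u p) * (v \<bullet> w)))"
    by (simp add: dir_deriv_f assms fs_metric_hopf_diff_horizontal[OF n dF_horizontal])
  have "kaehler_form (f p) (dir_deriv f p v) (dir_deriv f p w) = 0"
    using lagrangian assms by (simp add: lagrangian_map_def)
  then have "Re (bil (\<i> *s dir_deriv F p v) (conjv (dir_deriv F p w))) = 0"
    by (simp add: kaehler_form_def f_eq dir_deriv_f assms fs_J_hopf[OF n h]
        fs_metric_hopf_diff_horizontal[OF n dF_horizontal])
  then show "Im (bil (dir_deriv F p v) (conjv (dir_deriv F p w))) = Im (of_real (2 * exp (u p) * (v \<bullet> w)))"
    by simp
qed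

definition lap :: "complex \<Rightarrow> complex^4" where
  "lap p = second_deriv F p 1 1 + second_deriv F p \<i> \<i>"

text \<open>Horizontal lift of the mean curvature vector, up to the factor \<open>4 exp u\<close>.\<close>
definition hmc :: "complex \<Rightarrow> complex^4" where
  "hmc p = horizontal_proj (F p) (lap p)"

lemma hmc_horizontal: "p \<in> D \<Longrightarrow> hmc p \<in> horizontal_space (F p)"
  unfolding hmc_def by (rule horizontal_proj_mem[OF norm_F bil_F_F])

lemma second_deriv_commute: "p \<in> D \<Longrightarrow> second_deriv F p v w = second_deriv F p w v"
  by (rule dir_deriv_commute[OF open_D smooth_F])

text \<open>Derivative of the Hermitian Gram matrix of F_x and F_y, a scalar multiple of the
  identity. The scalar is kept as the product of F_x with itself because u is not known to be
  smooth.\<close>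

lemma bil_second_deriv_conjv:
  assumes "p \<in> D"
  shows "bil (second_deriv F p w a) (conjv (dir_deriv F p b)) + cnj (bil (second_deriv F p w b) (conjv (dir_deriv F p a)))
    = of_real (a \<bullet> b) * dir_deriv (\<lambda>q. bil (dir_deriv F q 1) (conjv (dir_deriv F q 1))) p w"
proof -
  have "dir_deriv (\<lambda>q. bil (dir_deriv F q a) (conjv (dir_deriv F q b))) p w =
      dir_deriv (\<lambda>q. of_real (a \<bullet> b) * bil (dir_deriv F q 1) (conjv (dir_deriv F q 1))) p w"
    by (rule dir_deriv_cong_open[OF open_D assms]) (simp add: bil_dF_conjv_dF)
  also have "\<dots> = of_real (a \<bullet> b) * dir_deriv (\<lambda>q. bil (dir_deriv F q 1) (conjv (dir_deriv F q 1))) p w"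
    by (rule dir_deriv_linear[OF bounded_linear_mult_right
        smooth_on_bil[OF open_D smooth_dF smooth_on_conjv[OF open_D smooth_dF]] assms])
  finally show ?thesis
    by (simp add: dir_deriv_bil[OF smooth_dF smooth_on_conjv[OF open_D smooth_dF] assms]
        dir_deriv_conjv[OF smooth_dF assms] cnj_bil_conjv add.commute)
qed

text \<open>
  The real part vanishes because the coordinates are conformal, the imaginary part is the derivative
  of the Lagrangian angle.
\<close>
lemma bil_hmc_dF:
  assumes "p \<in> D" "v = 1 \<or> v = \<i>"
  shows "bil (hmc p) (conjv (dir_deriv F p v)) =
    \<i> * Im (bil (second_deriv F p v 1) (conjv (dir_deriv F p 1))
            + bil (second_deriv F p v \<i>) (conjv (dir_deriv F p \<i>)))"
proof -
  define S where "S a b c = bil (second_deriv F p a b) (conjv (dir_deriv F p c))" for a b c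
  define m where "m w = dir_deriv (\<lambda>q. bil (dir_deriv F q 1) (conjv (dir_deriv F q 1))) p w" for w
  have S: "S w a b + cnj (S w b a) = of_real (a \<bullet> b) * m w" for w a b
    unfolding S_def m_def by (rule bil_second_deriv_conjv[OF assms(1)])
  have comm: "S a b c = S b a c" for a b c
    unfolding S_def by (simp only: second_deriv_commute[OF assms(1), of a b])
  have "bil (hmc p) (conjv (dir_deriv F p v)) = S 1 1 v + S \<i> \<i> v"
    unfolding hmc_def bil_horizontal_proj[OF horizontal_space_conjv[OF dF_horizontal[OF assms(1)]]]
    by (simp add: lap_def bil.add_left S_def)
  also have "\<dots> = \<i> * Im (S v 1 1 + S v \<i> \<i>)"
    using assms(2)
  proof
    \<comment> \<open>\<open>S \<i> \<i> 1\<close> is minus the conjugate of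
      \<open>S \<i> 1 \<i>\<close>, since the off-diagonal Gram entry vanishes identically, and
      symmetry of second derivatives turns the latter into \<open>S 1 \<i> \<i>\<close>. The real
      parts of \<open>S 1 1 1\<close> and \<open>S 1 \<i> \<i>\<close> agree, both being half the
      derivative of the conformal factor. The other case exchanges the roles of 1 and \<i>.\<close>
    assume v: "v = 1"
    show ?thesis
      using S[of 1 1 1] S[of \<i> \<i> 1] S[of 1 \<i> \<i>] comm[of 1 \<i> \<i>]
      by (simp add: v complex_eq_iff)
  next
    assume v: "v = \<i>"
    show ?thesis
      using S[of \<i> \<i> \<i>] S[of 1 1 \<i>] S[of \<i> 1 1] comm[of 1 \<i> 1]
      by (simp add: v complex_eq_iff)
  qed
  finally show ?thesis by (simp add: S_def)
qed

section \<open>The mean curvature vector\<close>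

text \<open>The tangent plane of the surface lifts to the real span of F_x and F_y, hence the real
  parts; the complex span is already the whole horizontal space.\<close>

definition normal_proj :: "complex \<Rightarrow> complex^4 \<Rightarrow> complex^4" where
  "normal_proj p w = w - (1 / (2 * exp (u p))) *\<^sub>R
    (Re (bil w (conjv (dir_deriv F p 1))) *\<^sub>R dir_deriv F p 1
     + Re (bil w (conjv (dir_deriv F p \<i>))) *\<^sub>R dir_deriv F p \<i>)"

definition normal_lift :: "complex \<Rightarrow> (complex^4) set" where
  "normal_lift p = {w \<in> horizontal_space (F p). \<forall>v. Re (bil w (conjv (dir_deriv F p v))) = 0}"

lemma tangent_space_f:
  "p \<in> D \<Longrightarrow> tangent_space Q2 (f p) = hopf_diff (F p) ` horizontal_space (F p)"
  by (simp add: f_eq tangent_space_Q2[OF norm_F bil_F_F])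

lemma normal_space_f:
  "p \<in> D \<Longrightarrow> normal_space Q2 f p = hopf_diff (F p) ` normal_lift p"
  by (auto simp: normal_space_def normal_lift_def tangent_space_f dir_deriv_f
      fs_metric_hopf_diff_horizontal[OF norm_F dF_horizontal])

lemma normal_proj_mem:
  assumes "p \<in> D" "w \<in> horizontal_space (F p)" shows "normal_proj p w \<in> normal_lift p"
proof -
  have "Re (bil (normal_proj p w) (conjv (dir_deriv F p v))) = 0" if "v = 1 \<or> v = \<i>" for v
    using that
    by (auto simp: normal_proj_def bil.diff_left bil.add_left bil.scaleR_left bil_dF_conjv_dF[OF assms(1)])
  then have "Re (bil (normal_proj p w) (conjv (dir_deriv F p v))) = 0" for v
    by (subst dF_eq[OF assms(1)]) (simp add: linear_simps[OF bounded_linear_conjv] bil.add_right bil.scaleR_right)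
  moreover have "normal_proj p w \<in> horizontal_space (F p)"
    unfolding normal_proj_def
    by (intro horizontal_space_diff horizontal_space_scaleR horizontal_space_add dF_horizontal assms)
  ultimately show ?thesis by (simp add: normal_lift_def)
qed

text \<open>The product rule splits the second derivative of f into a Hopf differential at F and a
  term orthogonal to the tangent space of the quadric. Projecting the former amounts to projecting
  the second derivative of the lift.\<close>

lemma levi_civita_f:
  assumes "p \<in> D"
  shows "levi_civita Q2 f p v w = hopf_diff (F p) (horizontal_proj (F p) (second_deriv F p v w))"
  unfolding levi_civita_def tangent_space_f[OF assms]
proof (rule orth_proj_eq)
  have "dir_deriv (\<lambda>q. dir_deriv f q w) p v = dir_deriv (\<lambda>q. hopf_diff (F q) (dir_deriv F q w)) p v"
    by (rule dir_deriv_cong_open[OF open_D assms]) (rule dir_deriv_f)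
  also have "\<dots> = hopf_diff (F p) (second_deriv F p v w) + hopf_diff (dir_deriv F p v) (dir_deriv F p w)"
    by (rule dir_deriv_bilinear[OF hopf.bounded_bilinear_axioms smooth_F smooth_dF assms])
  finally have D: "dir_deriv (\<lambda>q. dir_deriv f q w) p v =
    hopf_diff (F p) (second_deriv F p v w) + hopf_diff (dir_deriv F p v) (dir_deriv F p w)" .
  fix Z assume "Z \<in> hopf_diff (F p) ` horizontal_space (F p)"
  then obtain z where z: "z \<in> horizontal_space (F p)" "Z = hopf_diff (F p) z" by blast
  show "fs_metric (dir_deriv (\<lambda>q. dir_deriv f q w) p v
      - hopf_diff (F p) (horizontal_proj (F p) (second_deriv F p v w))) Z = 0"
    unfolding D z(2)
    by (simp add: fs.diff_left fs.add_left fs_metric_hopf_diff_horizontal[OF norm_F[OF assms] z(1)]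
        fs_metric_hopf_diff_vertical[OF dF_horizontal[OF assms] dF_horizontal[OF assms]]
        bil_horizontal_proj[OF horizontal_space_conjv[OF z(1)]])
qed (auto simp: hopf.diff_right[symmetric] horizontal_space_diff horizontal_proj_mem norm_F bil_F_F assms)

lemma second_ff_f:
  assumes "p \<in> D"
  shows "second_ff Q2 f p v w = hopf_diff (F p) (normal_proj p (horizontal_proj (F p) (second_deriv F p v w)))"
  unfolding second_ff_def normal_space_f[OF assms] levi_civita_f[OF assms]
proof (rule orth_proj_eq)
  let ?w = "horizontal_proj (F p) (second_deriv F p v w)"
  show "hopf_diff (F p) (normal_proj p ?w) \<in> hopf_diff (F p) ` normal_lift p"
    by (intro imageI normal_proj_mem assms horizontal_proj_mem norm_F bil_F_F)
  fix Z assume "Z \<in> hopf_diff (F p) ` normal_lift p"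
  then obtain z where z: "z \<in> horizontal_space (F p)" "Z = hopf_diff (F p) z"
    "\<And>v. Re (bil z (conjv (dir_deriv F p v))) = 0" by (auto simp: normal_lift_def)
  have "Re (bil (dir_deriv F p v) (conjv z)) = 0" for v
    using z(3)[of v] by (simp add: cnj_bil_conjv[of z, symmetric])
  then have "Re (bil (?w - normal_proj p ?w) (conjv z)) = 0"
    by (simp add: normal_proj_def bil.add_left bil.scaleR_left)
  then show "fs_metric (hopf_diff (F p) ?w - hopf_diff (F p) (normal_proj p ?w)) Z = 0"
    unfolding z(2) hopf.diff_right[symmetric]
    by (simp add: fs_metric_hopf_diff_horizontal[OF norm_F[OF assms] z(1)])
qed (auto simp: hopf.diff_right[symmetric] normal_lift_def horizontal_space_diff bil.diff_left intro!: imageI)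

lemma normal_proj_add: "normal_proj p (v + w) = normal_proj p v + normal_proj p w"
  by (simp add: normal_proj_def bil.add_left algebra_simps)

text \<open>In conformal coordinates both diagonal metric coefficients are 2 exp u and the mixed one
  is 0. The normal projection leaves the trace unchanged because, by \<open>bil_hmc_dF\<close>, the
  products of \<open>hmc p\<close> with F_x and F_y are purely imaginary.\<close>

lemma mean_curvature_vector_f:
  assumes "p \<in> D"
  shows "mean_curvature_vector Q2 f p = (1 / (4 * exp (u p))) *\<^sub>R hopf_diff (F p) (hmc p)"
proof -
  have E: "fs_metric (dir_deriv f p v) (dir_deriv f p w) = 2 * exp (u p) * (v \<bullet> w)" for v w
    using metric assms by (simp add: induced_metric_is_def)
  have "normal_proj p (hmc p) = hmc p"
    by (simp add: normal_proj_def bil_hmc_dF[OF assms])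
  moreover have "hmc p = horizontal_proj (F p) (second_deriv F p 1 1) + horizontal_proj (F p) (second_deriv F p \<i> \<i>)"
    by (simp add: hmc_def lap_def horizontal_proj_def bil.add_left sm.add_left)
  ultimately have "hopf_diff (F p) (hmc p) = second_ff Q2 f p 1 1 + second_ff Q2 f p \<i> \<i>"
    by (simp add: second_ff_f[OF assms] hopf.add_right[symmetric] normal_proj_add[symmetric])
  then show ?thesis
    by (simp add: mean_curvature_vector_def Let_def E scaleR_right_distrib)
qed

lemma minimal_iff: "minimal_in Q2 D f \<longleftrightarrow> (\<forall>p\<in>D. hmc p = 0)"
  using mean_curvature_vector_f hopf_diff_eq_0_iff[OF norm_F hmc_horizontal]
  by (auto simp: minimal_in_def)

end

section \<open>The Lagrangian angle\<close>

text \<open>The left inverse of a square matrix is a right inverse, so four biorthogonal pairs in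
  dimension four are dual bases.\<close>

lemma dual_basis_expand:
  fixes a b :: "4 \<Rightarrow> complex^4"
  assumes "\<And>j k. bil (a j) (b k) = (if j = k then 1 else 0)"
  shows "w = (\<Sum>k\<in>UNIV. bil w (a k) *s b k)"
proof -
  let ?A = "(\<chi> j l. a j $ l) :: complex^4^4" and ?B = "(\<chi> l k. b k $ l) :: complex^4^4"
  have "?A ** ?B = mat 1"
    using assms by (simp add: vec_eq_iff matrix_matrix_mult_def mat_def bil_def)
  then have "?B ** ?A = mat 1" using matrix_left_right_inverse by blast
  then have w: "w = ?B *v (?A *v w)" by (simp add: matrix_vector_mul_assoc)
  show ?thesis
    by (subst w) (simp add: vec_eq_iff matrix_vector_mult_def bil_def mult.commute)
qed

text \<open>The imaginary part of dg times the conjugate of g is |g|^2 times the differential of a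
  local argument. \<open>Arg\<close> itself is never differentiated: one direction rotates g into
  the real line, the other shows that g/|g| has zero derivative.\<close>

lemma Arg_constant_on_iff:
  assumes "open S" "connected S" "S \<noteq> {}" "smooth_on S g" "\<And>p. p \<in> S \<Longrightarrow> g p \<noteq> 0"
  shows "(\<lambda>p. Arg (g p)) constant_on S \<longleftrightarrow> (\<forall>p\<in>S. \<forall>v. Im (dir_deriv g p v * cnj (g p)) = 0)"
proof
  assume "(\<lambda>p. Arg (g p)) constant_on S"
  then obtain t where t: "\<And>p. p \<in> S \<Longrightarrow> Arg (g p) = t" by (auto simp: constant_on_def)
  show "\<forall>p\<in>S. \<forall>v. Im (dir_deriv g p v * cnj (g p)) = 0"
  proof (intro ballI allI)
    fix p v assume p: "p \<in> S"
    have g: "g q = of_real (cmod (g q)) * cis t" if "q \<in> S" for q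
      using t[OF that] Arg_eq[OF assms(5)[OF that]] by (simp add: cis_conv_exp)
    have L: "bounded_linear (\<lambda>z. Im (z * cnj (cis t)))"
      by (rule bounded_linear_compose[OF bounded_linear_Im bounded_linear_mult_left])
    have "Im (dir_deriv g p v * cnj (cis t)) = dir_deriv (\<lambda>q. Im (g q * cnj (cis t))) p v"
      by (rule dir_deriv_linear[OF L assms(4) p, symmetric])
    also have "\<dots> = dir_deriv (\<lambda>q. 0) p v"
    proof (rule dir_deriv_cong_open[OF assms(1) p])
      fix q assume "q \<in> S"
      from g[OF this] have "g q * cnj (cis t) = of_real (cmod (g q)) * (cis t * cnj (cis t))" by (metis mult.assoc)
      also have "cis t * cnj (cis t) = 1" by (simp add: cis_cnj cis_mult)
      finally show "Im (g q * cnj (cis t)) = 0" by simp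
    qed
    finally have "Im (dir_deriv g p v * cnj (cis t)) = 0" by (simp add: dir_deriv_const)
    moreover have "cnj (g p) = of_real (cmod (g p)) * cnj (cis t)"
      using arg_cong[OF g[OF p], of cnj] by (simp only: complex_cnj_mult complex_cnj_complex_of_real)
    then have "dir_deriv g p v * cnj (g p) = of_real (cmod (g p)) * (dir_deriv g p v * cnj (cis t))"
      by (simp only: mult.left_commute)
    moreover have "Im (of_real r * z) = r * Im z" for r z by simp
    ultimately show "Im (dir_deriv g p v * cnj (g p)) = 0" by (simp only: mult_zero_right)
  qed
next
  assume R: "\<forall>p\<in>S. \<forall>v. Im (dir_deriv g p v * cnj (g p)) = 0"
  obtain p0 where p0: "p0 \<in> S" using assms(3) by blast
  define n where "n p = sqrt (g p \<bullet> g p)" for p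
  have n: "smooth_on S n" unfolding n_def smooth_on_def
  proof
    fix k
    have "Ck_on k S g" using assms(4) by (simp add: smooth_on_def)
    then show "Ck_on k S (\<lambda>p. sqrt (g p \<bullet> g p))"
      by (intro Ck_on_sqrt[OF assms(1)] Ck_on_bilinear[OF assms(1) bounded_bilinear_inner])
        (use assms(5) in auto)
  qed
  have nn: "n p * n p = g p \<bullet> g p" "n p \<noteq> 0" if "p \<in> S" for p
    using assms(5)[OF that] by (simp_all add: n_def)
  have dn: "n p * dir_deriv n p v = g p \<bullet> dir_deriv g p v" if "p \<in> S" for p v
  proof -
    have "dir_deriv (\<lambda>q. n q * n q) p v = dir_deriv (\<lambda>q. g q \<bullet> g q) p v"
      by (rule dir_deriv_cong_open[OF assms(1) that]) (rule nn)
    then show ?thesis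
      by (simp add: dir_deriv_bilinear[OF bounded_bilinear_mult n n that]
          dir_deriv_bilinear[OF bounded_bilinear_inner assms(4,4) that] inner_commute mult.commute)
  qed
  have const: "g p / of_real (n p) = g p0 / of_real (n p0)" if "p \<in> S" for p
  proof (rule has_derivative_zero_unique_connected[OF assms(1,2) _ that p0])
    fix q assume q: "q \<in> S"
    note dg = smooth_on_has_derivative[OF assms(4) q]
    note dn' = bounded_linear.has_derivative[OF bounded_linear_of_real smooth_on_has_derivative[OF n q]]
    have nz: "complex_of_real (n q) \<noteq> 0" using nn[OF q] by simp
    show "((\<lambda>p. g p / of_real (n p)) has_derivative (\<lambda>v. 0)) (at q)"
    proof (rule has_derivative_eq_rhs[OF has_derivative_divide'[OF dg dn' nz]], rule ext)
      fix v
      \<comment> \<open>Multiplying by |g| makes |g|^2 appear, which is g times its conjugate. The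
        product of dg with that conjugate is real by hypothesis, hence equal to |g| d|g|.\<close>
      have "of_real (n q) * (dir_deriv g q v * of_real (n q)) = dir_deriv g q v * of_real (n q * n q)"
        by (simp add: algebra_simps)
      also have "\<dots> = dir_deriv g q v * cnj (g q) * g q"
        unfolding nn(1)[OF q] by (simp add: complex_eq_iff inner_complex_def algebra_simps)
      also have "dir_deriv g q v * cnj (g q) = of_real (n q * dir_deriv n q v)"
        unfolding dn[OF q] using R q by (simp add: complex_eq_iff inner_complex_def algebra_simps)
      also have "\<dots> * g q = of_real (n q) * (g q * of_real (dir_deriv n q v))" by (simp add: algebra_simps)
      finally have "dir_deriv g q v * of_real (n q) = g q * of_real (dir_deriv n q v)" using nz by simp
      then show "(dir_deriv g q v * of_real (n q) - g q * of_real (dir_deriv n q v)) / (of_real (n q) * of_real (n q)) = 0"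
        by simp
    qed
  qed
  have "Arg (g p) = Arg (g p0)" if "p \<in> S" for p
  proof -
    have pos: "n p > 0" "n p0 > 0" using assms(5)[OF that] assms(5)[OF p0] by (simp_all add: n_def)
    have "g p = of_real (n p / n p0) * g p0"
      using const[OF that] pos by (simp add: field_simps)
    then show ?thesis using pos Arg_times_of_real[of "n p / n p0" "g p0"] by simp
  qed
  then show "(\<lambda>p. Arg (g p)) constant_on S" by (auto simp: constant_on_def)
qed

text \<open>The hypotheses say that the symmetric matrix with rows (a, b) and (b, c) is a multiple
  of a unitary one: rows of equal length, orthogonal to each other. The real factor r does not turn
  the trace a + c; among the imaginary terms, those with k1 - k2 and with t cancel by these two
  relations.\<close>

lemma Im_deriv_sum_mult_cnj:
  fixes a b c :: complex and k1 k2 r t :: real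
  assumes "a * cnj a = c * cnj c" "b * cnj a + c * cnj b = 0"
  shows "2 * Im ((r * (a + c) + \<i> * k1 * a + \<i> * k2 * c + \<i> * t * b) * cnj (a + c)) = (k1 + k2) * (cmod (a + c))\<^sup>2"
proof -
  have 1: "(Re a)\<^sup>2 + (Im a)\<^sup>2 = (Re c)\<^sup>2 + (Im c)\<^sup>2"
    using assms(1) by (simp add: complex_eq_iff power2_eq_square)
  have 2: "Re b * Re a + Im b * Im a + Re c * Re b + Im c * Im b = 0"
    using arg_cong[OF assms(2), of Re] by simp
  have "2 * Im ((r * (a + c) + \<i> * k1 * a + \<i> * k2 * c + \<i> * t * b) * cnj (a + c))
      - (k1 + k2) * (cmod (a + c))\<^sup>2 =
      (k1 - k2) * (((Re a)\<^sup>2 + (Im a)\<^sup>2) - ((Re c)\<^sup>2 + (Im c)\<^sup>2))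
      + 2 * t * (Re b * Re a + Im b * Im a + Re c * Re b + Im c * Im b)"
    unfolding cmod_power2 by (simp add: algebra_simps power2_eq_square)
  also have "\<dots> = 0" unfolding 1 2 by simp
  finally show ?thesis by simp
qed

context lagrangian_lift
begin

text \<open>F, its conjugate, F_x and F_y are Hermitian orthogonal. Their dual basis for
  \<open>bil\<close> therefore consists of their conjugates, divided by 2 exp u in the last two
  places, and the first two coefficients of a horizontal vector vanish.\<close>

lemma horizontal_expand:
  assumes "p \<in> D" "w \<in> horizontal_space (F p)"
  shows "of_real (2 * exp (u p)) *s w = bil w (conjv (dir_deriv F p 1)) *s dir_deriv F p 1
    + bil w (conjv (dir_deriv F p \<i>)) *s dir_deriv F p \<i>"
proof -
  define q where "q = F p" define x where "x = dir_deriv F p 1" define y where "y = dir_deriv F p \<i>"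
  define m where "m = complex_of_real (2 * exp (u p))"
  define a where "a k = (if k = 1 then conjv q else if k = 2 then q else if k = 3 then (1/m) *s conjv x else (1/m) *s conjv y)" for k :: 4
  define b where "b k = (if k = 1 then q else if k = 2 then conjv q else if k = 3 then x else y)" for k :: 4
  have m: "m \<noteq> 0" by (simp add: m_def)
  have q: "bil q q = 0" "bil q (conjv q) = 1" "bil (conjv q) q = 1" "bil (conjv q) (conjv q) = 0"
    using norm_F[OF assms(1)] bil_F_F[OF assms(1)] bil_conjv_self[of q] cnj_bil[of q q]
    by (simp_all add: q_def bil_commute)
  have h: "x \<in> horizontal_space q" "y \<in> horizontal_space q"
    "conjv x \<in> horizontal_space q" "conjv y \<in> horizontal_space q"
    using dF_horizontal[OF assms(1)] horizontal_space_conjv by (auto simp: x_def y_def q_def)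
  have h': "bil z q = 0" "bil z (conjv q) = 0" "bil q z = 0" "bil (conjv q) z = 0" if "z \<in> horizontal_space q" for z
    using that by (auto simp: horizontal_space_def bil_commute)
  have xy: "bil (conjv x) x = m" "bil (conjv y) y = m" "bil (conjv x) y = 0" "bil (conjv y) x = 0"
    unfolding bil_commute[of "conjv _"] x_def y_def by (simp_all add: bil_dF_conjv_dF[OF assms(1)] m_def)
  have "\<forall>j k. bil (a j) (b k) = (if j = k then 1 else 0)"
    unfolding forall_4 a_def b_def using m by (simp add: q h h' xy)
  then have "w = (\<Sum>k\<in>UNIV. bil w (a k) *s b k)" by (intro dual_basis_expand) blast
  also have "\<dots> = bil w ((1/m) *s conjv x) *s x + bil w ((1/m) *s conjv y) *s y"
    using assms(2) by (simp add: sum_4 a_def b_def horizontal_space_def q_def)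
  finally have "m *s w = m *s (bil w ((1/m) *s conjv x) *s x + bil w ((1/m) *s conjv y) *s y)" by simp
  then show ?thesis
    using m unfolding m_def[symmetric] x_def[symmetric] y_def[symmetric]
    by (simp add: sm.add_right vector_smult_assoc)
qed

text \<open>Parseval's identity. Only z has to be horizontal, which allows w to be a second
  derivative of the lift.\<close>

lemma bil_expand:
  assumes "p \<in> D" "z \<in> horizontal_space (F p)"
  shows "of_real (2 * exp (u p)) * bil z w = bil w (conjv (dir_deriv F p 1)) * bil z (dir_deriv F p 1)
    + bil w (conjv (dir_deriv F p \<i>)) * bil z (dir_deriv F p \<i>)"
proof -
  have "bil z w = bil z (horizontal_proj (F p) w)"
    using bil_horizontal_proj[OF assms(2), of w] by (simp add: bil_commute)
  then have "of_real (2 * exp (u p)) * bil z w = bil z (of_real (2 * exp (u p)) *s horizontal_proj (F p) w)"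
    by simp
  also have "\<dots> = bil w (conjv (dir_deriv F p 1)) * bil z (dir_deriv F p 1)
    + bil w (conjv (dir_deriv F p \<i>)) * bil z (dir_deriv F p \<i>)"
    unfolding horizontal_expand[OF assms(1) horizontal_proj_mem[OF norm_F[OF assms(1)] bil_F_F[OF assms(1)]]]
    by (simp add: bil.add_right bil_horizontal_proj[OF horizontal_space_conjv[OF dF_horizontal[OF assms(1)]]])
  finally show ?thesis .
qed

lemma horizontal_eq_0_iff:
  assumes "p \<in> D" "w \<in> horizontal_space (F p)"
  shows "w = 0 \<longleftrightarrow> bil w (conjv (dir_deriv F p 1)) = 0 \<and> bil w (conjv (dir_deriv F p \<i>)) = 0"
proof
  assume "bil w (conjv (dir_deriv F p 1)) = 0 \<and> bil w (conjv (dir_deriv F p \<i>)) = 0"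
  then have "of_real (2 * exp (u p)) *s w = 0" using horizontal_expand[OF assms] by simp
  then show "w = 0" by simp
qed (simp add: bil.zero_left)

section \<open>The bilinear Gram matrix and the argument of \<beta>\<close>

definition "gram v w p = bil (dir_deriv F p v) (dir_deriv F p w)"

lemma beta_eq: "4 * beta F p = gram 1 1 p + gram \<i> \<i> p"
  by (simp add: beta_def wirt_z_def wirt_zbar_def gram_def bil.diff_left bil.add_right algebra_simps
      bil_commute[of "dir_deriv F p \<i>" "dir_deriv F p 1"])

lemma alpha_eq: "4 * alpha F p = gram 1 1 p - gram \<i> \<i> p - 2 * \<i> * gram 1 \<i> p"
  by (simp add: alpha_def wirt_z_def gram_def bil.diff_left bil.diff_right algebra_simps
      bil_commute[of "dir_deriv F p \<i>" "dir_deriv F p 1"])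

text \<open>Divided by 2 exp u, the bilinear Gram matrix is the change of basis between the
  orthonormal pair given by F_x, F_y and its conjugate pair, hence a symmetric unitary matrix. The
  relations are the lengths and the orthogonality of its rows.\<close>

lemma gram_relations:
  assumes "p \<in> D"
  shows "gram 1 1 p * cnj (gram 1 1 p) + gram 1 \<i> p * cnj (gram 1 \<i> p) = of_real (4 * exp (2 * u p))"
    and "gram \<i> \<i> p * cnj (gram \<i> \<i> p) + gram 1 \<i> p * cnj (gram 1 \<i> p) = of_real (4 * exp (2 * u p))"
    and "gram 1 \<i> p * cnj (gram 1 1 p) + gram \<i> \<i> p * cnj (gram 1 \<i> p) = 0"
proof -
  let ?x = "dir_deriv F p 1" and ?y = "dir_deriv F p \<i>"
  have e: "2 * exp (u p) * (2 * exp (u p)) = 4 * exp (2 * u p)" by (simp add: exp_double power2_eq_square)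
  note ex = bil_expand[OF assms dF_horizontal[OF assms]]
  show "gram 1 1 p * cnj (gram 1 1 p) + gram 1 \<i> p * cnj (gram 1 \<i> p) = of_real (4 * exp (2 * u p))"
    using ex[of 1 "conjv ?x"] unfolding e[symmetric]
    by (simp add: bil_dF_conjv_dF[OF assms] gram_def cnj_bil algebra_simps)
  show "gram \<i> \<i> p * cnj (gram \<i> \<i> p) + gram 1 \<i> p * cnj (gram 1 \<i> p) = of_real (4 * exp (2 * u p))"
    using ex[of \<i> "conjv ?y"] unfolding e[symmetric]
    by (simp add: bil_dF_conjv_dF[OF assms] gram_def cnj_bil bil_commute[of ?y ?x] bil_commute[of "conjv ?y" "conjv ?x"] algebra_simps)
  show "gram 1 \<i> p * cnj (gram 1 1 p) + gram \<i> \<i> p * cnj (gram 1 \<i> p) = 0"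
    using ex[of \<i> "conjv ?x"]
    by (simp add: bil_dF_conjv_dF[OF assms] gram_def cnj_bil bil_commute[of ?y ?x] algebra_simps)
qed

text \<open>The terms mixing the two diagonal Gram entries cancel between |\<alpha>|^2 and
  |\<beta>|^2, those with the off-diagonal entry cancel by orthogonality of the rows. With the gap
  assumption this gives \<beta> a well-defined argument.\<close>

lemma cmod_alpha_beta:
  assumes "p \<in> D" shows "(cmod (alpha F p))\<^sup>2 + (cmod (beta F p))\<^sup>2 = exp (2 * u p)"
proof -
  define a b c where "a = gram 1 1 p" and "b = gram 1 \<i> p" and "c = gram \<i> \<i> p"
  note r = gram_relations[OF assms, folded a_def b_def c_def]
  have r3: "b * cnj c = - (a * cnj b)"
    using arg_cong[OF r(3), of cnj] by (simp add: add_eq_0_iff2 algebra_simps)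
  have r4: "b * cnj a = - (c * cnj b)" using r(3) by (simp add: add_eq_0_iff)
  have "16 * (alpha F p * cnj (alpha F p) + beta F p * cnj (beta F p))
      = (4 * alpha F p) * cnj (4 * alpha F p) + (4 * beta F p) * cnj (4 * beta F p)" by simp
  also have "\<dots> = 2 * (a * cnj a + b * cnj b) + 2 * (c * cnj c + b * cnj b)
      + 2 * \<i> * (a * cnj b - c * cnj b - b * cnj a + b * cnj c)"
    unfolding alpha_eq beta_eq a_def[symmetric] b_def[symmetric] c_def[symmetric] by (simp add: algebra_simps)
  also have "\<dots> = of_real (16 * exp (2 * u p))"
    unfolding r r3 r4 by simp
  finally have "16 * (alpha F p * cnj (alpha F p) + beta F p * cnj (beta F p)) = 16 * of_real (exp (2 * u p))"
    by (simp only: of_real_mult of_real_numeral)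
  then have "alpha F p * cnj (alpha F p) + beta F p * cnj (beta F p) = of_real (exp (2 * u p))"
    by (metis mult_left_cancel zero_neq_numeral)
  then have "complex_of_real ((cmod (alpha F p))\<^sup>2 + (cmod (beta F p))\<^sup>2) = of_real (exp (2 * u p))"
    by (simp add: complex_norm_square[symmetric] del: of_real_power)
  then show ?thesis by (simp only: of_real_eq_iff)
qed

lemma beta_nonzero: "p \<in> D \<Longrightarrow> beta F p \<noteq> 0"
  using gap cmod_alpha_beta by fastforce

lemma smooth_wirt_z: "smooth_on D (wirt_z F)" and smooth_wirt_zbar: "smooth_on D (wirt_zbar F)"
proof -
  note lin = smooth_on_linear[OF sm.bounded_linear_right open_D]
  have "smooth_on D (\<lambda>p. (1/2) *s (dir_deriv F p 1 + (- \<i>) *s dir_deriv F p \<i>))"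
    and "smooth_on D (\<lambda>p. (1/2) *s (dir_deriv F p 1 + \<i> *s dir_deriv F p \<i>))"
    by (rule lin[OF smooth_on_add[OF open_D smooth_dF lin[OF smooth_dF]]])+
  then show "smooth_on D (wirt_z F)" "smooth_on D (wirt_zbar F)"
    by (simp_all add: wirt_z_def[abs_def] wirt_zbar_def[abs_def])
qed

lemma smooth_alpha: "smooth_on D (alpha F)" and smooth_beta: "smooth_on D (beta F)"
  unfolding alpha_def[abs_def] beta_def[abs_def]
  by (rule smooth_on_bil[OF open_D smooth_wirt_z smooth_wirt_z])
    (rule smooth_on_bil[OF open_D smooth_wirt_z smooth_wirt_zbar])

text \<open>The squared trace of a two by two unitary matrix is a nonnegative multiple of its
  determinant. So the argument of \<beta>, a multiple of the trace, moves like half the argument of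
  the Gram determinant, and this is governed by the trace of the connection coefficients S, whose
  imaginary part is that of the product of h with the derivative of F. The computation
  differentiates the Gram trace directly.\<close>

lemma Im_dir_deriv_beta:
  assumes "p \<in> D" "v = 1 \<or> v = \<i>"
  shows "2 * exp (u p) * Im (dir_deriv (beta F) p v * cnj (beta F p)) =
    Im (bil (hmc p) (conjv (dir_deriv F p v))) * (cmod (beta F p))\<^sup>2"
proof -
  define a b c where "a = gram 1 1 p" and "b = gram 1 \<i> p" and "c = gram \<i> \<i> p"
  define S where "S j k = bil (second_deriv F p v j) (conjv (dir_deriv F p k))" for j k
  define m where "m = dir_deriv (\<lambda>q. bil (dir_deriv F q 1) (conjv (dir_deriv F q 1))) p v"
  have S: "S j k + cnj (S k j) = of_real (j \<bullet> k) * m" for j k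
    unfolding S_def m_def by (rule bil_second_deriv_conjv[OF assms(1)])
  note r = gram_relations[OF assms(1), folded a_def b_def c_def]
  have s: "4 * beta F p = a + c" using beta_eq by (simp add: a_def c_def)
  have db: "4 * dir_deriv (beta F) p v =
     2 * (bil (dir_deriv F p 1) (second_deriv F p v 1) + bil (dir_deriv F p \<i>) (second_deriv F p v \<i>))"
  proof -
    have "4 * dir_deriv (beta F) p v = dir_deriv (\<lambda>q. 4 * beta F q) p v"
      by (rule dir_deriv_linear[OF bounded_linear_mult_right smooth_beta assms(1), symmetric])
    also have "\<dots> = dir_deriv (\<lambda>q. gram 1 1 q + gram \<i> \<i> q) p v" unfolding beta_eq ..
    also have "\<dots> = dir_deriv (gram 1 1) p v + dir_deriv (gram \<i> \<i>) p v"
      unfolding gram_def[abs_def]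
      by (rule dir_deriv_eq, rule has_derivative_add)
        (rule smooth_on_has_derivative[OF smooth_on_bil[OF open_D smooth_dF smooth_dF] assms(1)])+
    also have "\<dots> = 2 * (bil (dir_deriv F p 1) (second_deriv F p v 1) + bil (dir_deriv F p \<i>) (second_deriv F p v \<i>))"
      unfolding gram_def[abs_def]
      by (simp add: dir_deriv_bil[OF smooth_dF smooth_dF assms(1)] bil_commute[of "second_deriv F p _ _"])
    finally show ?thesis .
  qed
  have ex: "of_real (2 * exp (u p)) * bil (dir_deriv F p j) (second_deriv F p v j) = S j 1 * gram j 1 p + S j \<i> * gram j \<i> p" for j
    unfolding S_def gram_def by (rule bil_expand[OF assms(1) dF_horizontal[OF assms(1)]])
  have g: "gram \<i> 1 p = b" by (simp add: b_def gram_def bil_commute)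
  \<comment> \<open>S is a real multiple of the identity plus a skew-Hermitian matrix: equal real
    parts on the diagonal and a purely imaginary off-diagonal sum, the shape required by
    \<open>Im_deriv_sum_mult_cnj\<close>.\<close>
  have S1: "S 1 1 = Re m / 2 + \<i> * Im (S 1 1)" "S \<i> \<i> = Re m / 2 + \<i> * Im (S \<i> \<i>)"
    using S[of 1 1] S[of \<i> \<i>] by (simp_all add: complex_eq_iff)
  have S2: "S 1 \<i> + S \<i> 1 = \<i> * of_real (2 * Im (S 1 \<i>))"
    using S[of 1 \<i>] by (simp add: complex_eq_iff)
  define X where "X = (of_real (Re m / 2) * (a + c) + \<i> * of_real (Im (S 1 1)) * a
      + \<i> * of_real (Im (S \<i> \<i>)) * c + \<i> * of_real (2 * Im (S 1 \<i>)) * b) * cnj (a + c)"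
  have "of_real (2 * exp (u p)) * (4 * dir_deriv (beta F) p v) =
      2 * (S 1 1 * a + (S 1 \<i> + S \<i> 1) * b + S \<i> \<i> * c)"
  proof -
    have "of_real (2 * exp (u p)) * (4 * dir_deriv (beta F) p v) =
      2 * (of_real (2 * exp (u p)) * bil (dir_deriv F p 1) (second_deriv F p v 1)
         + of_real (2 * exp (u p)) * bil (dir_deriv F p \<i>) (second_deriv F p v \<i>))"
      unfolding db by (simp add: algebra_simps)
    also have "\<dots> = 2 * (S 1 1 * a + (S 1 \<i> + S \<i> 1) * b + S \<i> \<i> * c)"
      unfolding ex g a_def[symmetric] b_def[symmetric] c_def[symmetric] by (simp add: algebra_simps)
    finally show ?thesis .
  qed
  also have "\<dots> = 2 * (of_real (Re m / 2) * (a + c) + \<i> * of_real (Im (S 1 1)) * a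
      + \<i> * of_real (Im (S \<i> \<i>)) * c + \<i> * of_real (2 * Im (S 1 \<i>)) * b)"
    by (subst S1(1), subst S1(2), subst S2) (simp add: algebra_simps)
  finally have "of_real (2 * exp (u p)) * (4 * dir_deriv (beta F) p v) * cnj (a + c) = 2 * X"
    unfolding X_def by (simp only: mult.assoc)
  then have "Im (of_real (2 * exp (u p)) * (4 * dir_deriv (beta F) p v) * cnj (a + c)) = Im (2 * X)" by (rule arg_cong)
  also have "\<dots> = 2 * Im X" by simp
  also have "\<dots> = (Im (S 1 1) + Im (S \<i> \<i>)) * (cmod (a + c))\<^sup>2"
    unfolding X_def by (rule Im_deriv_sum_mult_cnj[OF _ r(3)]) (metis r(1,2) add_right_cancel)
  finally have "Im (of_real (2 * exp (u p)) * (4 * dir_deriv (beta F) p v) * cnj (a + c)) =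
     (Im (S 1 1) + Im (S \<i> \<i>)) * (cmod (a + c))\<^sup>2" .
  then have "16 * (2 * exp (u p) * Im (dir_deriv (beta F) p v * cnj (beta F p))) =
     16 * ((Im (S 1 1) + Im (S \<i> \<i>)) * (cmod (beta F p))\<^sup>2)"
    unfolding s[symmetric] by (simp add: norm_mult power_mult_distrib algebra_simps)
  then have "2 * exp (u p) * Im (dir_deriv (beta F) p v * cnj (beta F p)) =
     (Im (S 1 1) + Im (S \<i> \<i>)) * (cmod (beta F p))\<^sup>2"
    by (metis mult_left_cancel zero_neq_numeral)
  moreover have "Im (bil (hmc p) (conjv (dir_deriv F p v))) = Im (S 1 1) + Im (S \<i> \<i>)"
    unfolding bil_hmc_dF[OF assms] S_def by simp
  ultimately show ?thesis by simp
qed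

lemma hmc_eq_0_iff:
  assumes "p \<in> D"
  shows "hmc p = 0 \<longleftrightarrow> (\<forall>v. Im (dir_deriv (beta F) p v * cnj (beta F p)) = 0)"
proof -
  have re: "Re (bil (hmc p) (conjv (dir_deriv F p v))) = 0" if "v = 1 \<or> v = \<i>" for v
    unfolding bil_hmc_dF[OF assms that] by simp
  have *: "bil (hmc p) (conjv (dir_deriv F p v)) = 0 \<longleftrightarrow> Im (dir_deriv (beta F) p v * cnj (beta F p)) = 0"
    if "v = 1 \<or> v = \<i>" for v
    using Im_dir_deriv_beta[OF assms that] beta_nonzero[OF assms] re[OF that]
    by (auto simp: complex_eq_iff)
  have "(\<forall>v. Im (dir_deriv (beta F) p v * cnj (beta F p)) = 0) \<longleftrightarrow>
    Im (dir_deriv (beta F) p 1 * cnj (beta F p)) = 0 \<and> Im (dir_deriv (beta F) p \<i> * cnj (beta F p)) = 0"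
    (is "?L \<longleftrightarrow> ?R")
  proof (intro iffI allI)
    fix v assume ?R
    have "dir_deriv (beta F) p v * cnj (beta F p) =
      Re v *\<^sub>R (dir_deriv (beta F) p 1 * cnj (beta F p)) + Im v *\<^sub>R (dir_deriv (beta F) p \<i> * cnj (beta F p))"
      by (subst dir_deriv_complex[OF smooth_on_has_derivative[OF smooth_beta assms]]) (simp add: algebra_simps)
    with \<open>?R\<close> show "Im (dir_deriv (beta F) p v * cnj (beta F p)) = 0"
      by (simp only: complex_add_cnj plus_complex.simps scaleR_complex.simps)
  qed simp
  then show ?thesis
    unfolding horizontal_eq_0_iff[OF assms hmc_horizontal[OF assms]] by (simp only: *[of 1] *[of \<i>] simp_thms)
qed

lemma Arg_beta_constant_iff: "(\<lambda>p. Arg (beta F p)) constant_on D \<longleftrightarrow> (\<forall>p\<in>D. hmc p = 0)"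
  by (rule trans[OF Arg_constant_on_iff[OF open_D connected_D nonempty_D smooth_beta beta_nonzero]])
    (auto simp: hmc_eq_0_iff)

text \<open>The zbar-derivative of \<alpha> is twice the bilinear product of F_z with a quarter of
  the Laplacian of F; as F_z is horizontal, only h contributes.\<close>

lemma alpha_holomorphic:
  assumes "\<forall>p\<in>D. hmc p = 0" shows "alpha F holomorphic_on D"
proof -
  have "(alpha F has_field_derivative dir_deriv (alpha F) p 1) (at p)" if p: "p \<in> D" for p
  proof -
    have w: "wirt_z F p \<in> horizontal_space (F p)"
      using dF_horizontal[OF p] by (simp add: wirt_z_def horizontal_space_def bil.diff_left)
    have dw: "dir_deriv (wirt_z F) p v = (1/2) *s (second_deriv F p v 1 - \<i> *s second_deriv F p v \<i>)" for v
      unfolding wirt_z_def[abs_def]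
      by (rule dir_deriv_eq[OF bounded_linear.has_derivative[OF sm.bounded_linear_right
           has_derivative_diff[OF smooth_on_has_derivative[OF smooth_dF p]
           bounded_linear.has_derivative[OF sm.bounded_linear_right smooth_on_has_derivative[OF smooth_dF p]]]]])
    have d: "dir_deriv (alpha F) p v = 2 * bil (wirt_z F p) (dir_deriv (wirt_z F) p v)" for v
      unfolding alpha_def[abs_def]
      by (simp add: dir_deriv_bil[OF smooth_wirt_z smooth_wirt_z p] bil_commute[of "dir_deriv _ _ _"])
    \<comment> \<open>The factorisation of half the Laplacian as d_x + \<i> d_y applied to F_z,
      solved for the derivative in the direction \<i>.\<close>
    have "dir_deriv (wirt_z F) p \<i> = \<i> *s dir_deriv (wirt_z F) p 1 + (- \<i> / 2) *s lap p"
      unfolding dw lap_def second_deriv_commute[OF p, of \<i> 1]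
      by (simp add: vec_eq_iff algebra_simps)
    moreover have "bil (hmc p) (wirt_z F p) = bil (lap p) (wirt_z F p)"
      unfolding hmc_def by (rule bil_horizontal_proj[OF w])
    then have "bil (wirt_z F p) (lap p) = 0"
      using assms p by (simp add: bil.zero_left bil_commute[of "wirt_z F p"])
    ultimately have i: "dir_deriv (alpha F) p \<i> = \<i> * dir_deriv (alpha F) p 1"
      unfolding d by (simp add: bil.add_right bil.diff_right)
    have "dir_deriv (alpha F) p = (*) (dir_deriv (alpha F) p 1)"
    proof
      fix v
      have "dir_deriv (alpha F) p v = Re v *\<^sub>R dir_deriv (alpha F) p 1 + Im v *\<^sub>R (\<i> * dir_deriv (alpha F) p 1)"
        using dir_deriv_complex[OF smooth_on_has_derivative[OF smooth_alpha p], of v] i by simp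
      then show "dir_deriv (alpha F) p v = dir_deriv (alpha F) p 1 * v"
        by (simp add: complex_eq_iff algebra_simps)
    qed
    then show ?thesis
      using smooth_on_has_derivative[OF smooth_alpha p] by (simp add: has_field_derivative_def)
  qed
  then show ?thesis
    unfolding holomorphic_on_def by (meson field_differentiable_def field_differentiable_at_within)
qed

end

section \<open>The loop of connections of an orthogonal frame\<close>

lemma bounded_linear_cscale: "bounded_linear (cscale c)"
  unfolding linear_conv_bounded_linear[symmetric]
  by (auto intro!: linearI simp: cscale_def vec_eq_iff algebra_simps)

lemma cscale_nth [simp]: "cscale c A $ j $ k = c * A $ j $ k"
  by (simp add: cscale_def)

lemma cscale_mult_left [simp]: "cscale c A ** B = cscale c (A ** B)"
  and cscale_mult_right [simp]: "A ** cscale c B = cscale c (A ** B)"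
  by (simp_all add: vec_eq_iff matrix_matrix_mult_def sum_distrib_left algebra_simps)

definition k_proj :: "complex^4^4 \<Rightarrow> complex^4^4" where
  "k_proj A = (1/2) *\<^sub>R (A + sigma ** A ** sigma)"

definition p_proj :: "complex^4^4 \<Rightarrow> complex^4^4" where
  "p_proj A = (1/2) *\<^sub>R (A - sigma ** A ** sigma)"

lemma sigma_conj_nth:
  "(sigma ** A ** sigma) $ j $ k = (if (j = 1 \<or> j = 2) = (k = 1 \<or> k = 2) then A $ j $ k else - A $ j $ k)"
proof -
  have 1: "(sigma ** B) $ j $ k = (if j = 1 \<or> j = 2 then B $ j $ k else - B $ j $ k)" for B j k
    by (simp add: matrix_matrix_mult_def sigma_def if_distrib[where f="\<lambda>x. x * _"] cong: if_cong)
  have 2: "(B ** sigma) $ j $ k = (if k = 1 \<or> k = 2 then B $ j $ k else - B $ j $ k)" for B j k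
    by (simp add: matrix_matrix_mult_def sigma_def if_distrib[where f="\<lambda>x. _ * x"] cong: if_cong)
  show ?thesis by (auto simp: 1 2)
qed

lemma k_proj_nth: "k_proj A $ j $ k = (if (j = 1 \<or> j = 2) = (k = 1 \<or> k = 2) then A $ j $ k else 0)"
  and p_proj_nth: "p_proj A $ j $ k = (if (j = 1 \<or> j = 2) = (k = 1 \<or> k = 2) then 0 else A $ j $ k)"
  unfolding k_proj_def p_proj_def
  by (simp_all only: vector_scaleR_component vector_add_component vector_minus_component sigma_conj_nth)
    (auto simp: scaleR_conv_of_real[where 'a=complex])

text \<open>The grading of block matrices by \<open>sigma\<close>; on commutators it becomes the
  bracket relations of a symmetric space: [k,k] and [p,p] lie in k, [k,p] lies in p.\<close>

lemma k_proj_mult: "k_proj (A ** B) = k_proj A ** k_proj B + p_proj A ** p_proj B"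
  and p_proj_mult: "p_proj (A ** B) = k_proj A ** p_proj B + p_proj A ** k_proj B"
  by (simp_all add: vec_eq_iff forall_4 matrix_matrix_mult_def sum_4 k_proj_nth p_proj_nth)

lemma linear_k_proj: "bounded_linear k_proj" and linear_p_proj: "bounded_linear p_proj"
  unfolding linear_conv_bounded_linear[symmetric]
  by (auto intro!: linearI simp: vec_eq_iff k_proj_nth p_proj_nth)

lemmas k_proj_simps = linear_simps[OF linear_k_proj] and p_proj_simps = linear_simps[OF linear_p_proj]
lemmas cscale_simps = linear_simps[OF bounded_linear_cscale]
lemmas transpose_simps = linear_simps[OF bounded_linear_transpose]

lemma comm_swap: "comm A B = - comm B A"
  by (simp add: comm_def)

text \<open>
  For \<open>l\<close> on the unit circle, \<open>c\<close> and \<open>s\<close> below are the cosine and minus the sine of the argument of \<open>l\<close>.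
\<close>
lemma comm_rotated:
  "comm (K1 + cscale c P1 + cscale s P2) (K2 + cscale c P2 - cscale s P1) =
    comm K1 K2 + cscale (c * c + s * s) (comm P1 P2) + cscale c (comm K1 P2 + comm P1 K2)
    - cscale s (comm K1 P1 + comm K2 P2)"
  by (simp add: comm_def mm.add_left mm.add_right mm.diff_left mm.diff_right)
    (simp add: vec_eq_iff algebra_simps)

lemma matrix_inv_eq:
  fixes A B :: "complex^4^4"
  assumes "B ** A = mat 1" shows "matrix_inv A = B"
proof -
  have AB: "A ** B = mat 1" using assms matrix_left_right_inverse by blast
  have "A ** matrix_inv A = mat 1 \<and> matrix_inv A ** A = mat 1"
    unfolding matrix_inv_def by (rule someI[of _ B]) (simp add: AB assms)
  then show ?thesis by (metis assms matrix_mul_assoc matrix_mul_lid matrix_mul_rid)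
qed

text \<open>Two-forms on a plane have one coefficient, so the curvature has to be computed only on
  the directions 1 and \<i>.\<close>

lemma alternating_eq:
  fixes B :: "complex \<Rightarrow> complex \<Rightarrow> 'a::real_vector"
  assumes anti: "\<And>v w. B v w = - B w v" and lin: "\<And>v w. B v w = Re v *\<^sub>R B 1 w + Im v *\<^sub>R B \<i> w"
  shows "B v w = (Re v * Im w - Im v * Re w) *\<^sub>R B 1 \<i>"
proof -
  have 0: "B x x = 0" for x
  proof -
    have "B x x + B x x = 0" using anti[of x x] unfolding eq_neg_iff_add_eq_0 .
    then have "2 *\<^sub>R B x x = 0" by (simp only: scaleR_2)
    then show ?thesis by simp
  qed
  have 1: "B 1 w = Im w *\<^sub>R B 1 \<i>"
    using anti[of 1 w] lin[of w 1] anti[of \<i> 1] by (simp add: 0)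
  have 2: "B \<i> w = - (Re w *\<^sub>R B 1 \<i>)"
    using anti[of \<i> w] lin[of w \<i>] by (simp add: 0)
  show ?thesis by (subst lin, subst 1, subst 2) (simp add: algebra_simps)
qed

text \<open>Orthogonality refers to the transpose, not to the adjoint, and entries may be complex.
  This suffices to replace the inverse by the transpose and to make the connection form
  skew.\<close>

locale orthogonal_frame =
  fixes D :: "complex set" and M :: "complex \<Rightarrow> complex^4^4"
  assumes open_dom: "open D" and smooth_M: "smooth_on D M"
    and orthogonal: "\<And>q. q \<in> D \<Longrightarrow> transpose (M q) ** M q = mat 1"
begin

definition theta :: "complex \<Rightarrow> complex \<Rightarrow> complex^4^4" where
  "theta v q = transpose (M q) ** dir_deriv M q v"

lemma maurer_cartan_eq: "q \<in> D \<Longrightarrow> maurer_cartan M q v = theta v q"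
  by (simp add: maurer_cartan_def theta_def matrix_inv_eq[OF orthogonal])

lemma orthogonal': "q \<in> D \<Longrightarrow> M q ** transpose (M q) = mat 1"
  using orthogonal matrix_left_right_inverse by blast

lemma dM_eq: "q \<in> D \<Longrightarrow> dir_deriv M q v = M q ** theta v q"
  by (simp add: theta_def matrix_mul_assoc orthogonal')

lemmas smooth_dM = smooth_on_dir_deriv[OF smooth_M]

lemma smooth_theta: "smooth_on D (theta v)"
  unfolding theta_def[abs_def]
  by (rule smooth_on_bilinear[OF mm.bounded_bilinear_axioms open_dom
        smooth_on_linear[OF bounded_linear_transpose open_dom smooth_M] smooth_dM])

lemma theta_linear:
  assumes "q \<in> D" shows "theta v q = Re v *\<^sub>R theta 1 q + Im v *\<^sub>R theta \<i> q"
  unfolding theta_def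
  by (subst dir_deriv_complex[OF smooth_on_has_derivative[OF smooth_M assms]])
    (simp add: mm.add_right mm.scaleR_right)

lemma theta_skew: assumes "q \<in> D" shows "transpose (theta v q) = - theta v q"
proof -
  have "dir_deriv (\<lambda>q. transpose (M q) ** M q) q v = dir_deriv (\<lambda>q. mat 1) q v"
    by (rule dir_deriv_cong_open[OF open_dom assms]) (rule orthogonal)
  then have "transpose (M q) ** dir_deriv M q v + transpose (dir_deriv M q v) ** M q = 0"
    by (simp add: dir_deriv_const dir_deriv_linear[OF bounded_linear_transpose smooth_M assms]
        dir_deriv_bilinear[OF mm.bounded_bilinear_axioms smooth_on_linear[OF bounded_linear_transpose open_dom smooth_M]
          smooth_M assms])
  then show ?thesis
    by (simp add: theta_def matrix_transpose_mul eq_neg_iff_add_eq_0 add.commute)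
qed

lemma dtheta:
  assumes "p \<in> D"
  shows "dir_deriv (theta w) p v = transpose (M p) ** dir_deriv (\<lambda>q. dir_deriv M q w) p v - theta v p ** theta w p"
proof -
  have "dir_deriv (theta w) p v = transpose (M p) ** dir_deriv (\<lambda>q. dir_deriv M q w) p v
      + transpose (dir_deriv M p v) ** dir_deriv M p w"
    unfolding theta_def[abs_def]
    by (simp add: dir_deriv_linear[OF bounded_linear_transpose smooth_M assms]
        dir_deriv_bilinear[OF mm.bounded_bilinear_axioms smooth_on_linear[OF bounded_linear_transpose open_dom smooth_M]
          smooth_dM assms])
  also have "transpose (dir_deriv M p v) ** dir_deriv M p w = transpose (theta v p) ** (transpose (M p) ** M p) ** theta w p"
    unfolding dM_eq[OF assms] matrix_transpose_mul by (simp add: matrix_mul_assoc)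
  also have "\<dots> = - (theta v p ** theta w p)"
    by (simp add: orthogonal assms theta_skew mm.minus_left)
  finally show ?thesis by simp
qed

text \<open>Equality of the mixed second derivatives of M; it is flatness of the connection at the
  parameter 1.\<close>

lemma maurer_cartan_equation:
  assumes "p \<in> D"
  shows "dir_deriv (theta w) p v - dir_deriv (theta v) p w = - comm (theta v p) (theta w p)"
  unfolding dtheta[OF assms] dir_deriv_commute[OF open_dom smooth_M assms, of w v]
  by (simp add: comm_def)

abbreviation "K v q \<equiv> k_proj (theta v q)"
abbreviation "P v q \<equiv> p_proj (theta v q)"

text \<open>Collecting the powers of l in the (1,0) and (0,1) parts leaves a combination of P at v
  and at \<i> v. For |l| = 1 it equals, on D, P at \<open>cnj l * v\<close>: the loop rotates the
  argument of the p-part.\<close>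

definition loop :: "complex \<Rightarrow> complex \<Rightarrow> complex \<Rightarrow> complex^4^4" where
  "loop l v q = K v q + cscale ((l + inverse l) / 2) (P v q) + cscale (\<i> * (l - inverse l) / 2) (P (\<i> * v) q)"

lemma loop_form_eq:
  assumes "q \<in> D" shows "loop_form (maurer_cartan M) l q v = loop l v q"
proof -
  have k: "k_part (maurer_cartan M) q v = K v q" and p: "p_part (maurer_cartan M) q v = P v q" for v
    by (simp_all add: k_part_def p_part_def k_proj_def p_proj_def maurer_cartan_eq[OF assms])
  show ?thesis
    unfolding loop_form_def part10_def part01_def k p loop_def
    by (simp add: vec_eq_iff scaleR_conv_of_real[where 'a=complex] algebra_simps add_divide_distrib diff_divide_distrib)
qed

lemma smooth_loop: "smooth_on D (loop l v)"
  unfolding loop_def[abs_def]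
  by (intro smooth_on_add open_dom smooth_on_linear[OF bounded_linear_cscale open_dom]
      smooth_on_linear[OF linear_k_proj open_dom] smooth_on_linear[OF linear_p_proj open_dom] smooth_theta)

lemma loop_linear:
  assumes "q \<in> D" shows "loop l v q = Re v *\<^sub>R loop l 1 q + Im v *\<^sub>R loop l \<i> q"
proof -
  have "theta (\<i> * v) q = Re v *\<^sub>R theta (\<i> * 1) q + Im v *\<^sub>R theta (\<i> * \<i>) q"
    unfolding theta_linear[OF assms, of "\<i> * _"] by (simp add: algebra_simps)
  then show ?thesis
    unfolding loop_def theta_linear[OF assms, of v]
    by (simp add: k_proj_simps p_proj_simps cscale_simps algebra_simps)
qed

section \<open>Curvature of the loop and its obstruction to flatness\<close>

definition curvature :: "complex \<Rightarrow> complex \<Rightarrow> complex \<Rightarrow> complex \<Rightarrow> complex^4^4" where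
  "curvature l p v w = dir_deriv (loop l w) p v - dir_deriv (loop l v) p w + comm (loop l v p) (loop l w p)"

lemma flat_connection_iff:
  "flat_connection D (loop_form (maurer_cartan M) l) \<longleftrightarrow> (\<forall>p\<in>D. \<forall>v w. curvature l p v w = 0)"
proof -
  have "ext_deriv (loop_form (maurer_cartan M) l) p v w = dir_deriv (loop l w) p v - dir_deriv (loop l v) p w"
    if "p \<in> D" for p v w
  proof -
    have "dir_deriv (\<lambda>q. loop_form (maurer_cartan M) l q w) p v = dir_deriv (loop l w) p v" for v w
      by (rule dir_deriv_cong_open[OF open_dom that]) (rule loop_form_eq)
    then show ?thesis by (simp only: ext_deriv_def)
  qed
  moreover have "(1/2) *\<^sub>R wedge_bracket (loop_form (maurer_cartan M) l) (loop_form (maurer_cartan M) l) p v w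
     = comm (loop l v p) (loop l w p)" if "p \<in> D" for p v w
    unfolding wedge_bracket_def loop_form_eq[OF that] comm_swap[of "loop l w p"]
    by (simp add: scaleR_2[symmetric])
  ultimately show ?thesis by (simp add: flat_connection_def curvature_def)
qed

lemma curvature_eq:
  assumes "p \<in> D"
  shows "curvature l p v w = (Re v * Im w - Im v * Re w) *\<^sub>R curvature l p 1 \<i>"
proof (rule alternating_eq)
  fix v w
  show "curvature l p v w = - curvature l p w v"
    by (simp add: curvature_def comm_swap[of "loop l w p"])
  have d: "dir_deriv (loop l v) p w = Re v *\<^sub>R dir_deriv (loop l 1) p w + Im v *\<^sub>R dir_deriv (loop l \<i>) p w"
  proof -
    have "dir_deriv (loop l v) p w = dir_deriv (\<lambda>q. Re v *\<^sub>R loop l 1 q + Im v *\<^sub>R loop l \<i> q) p w"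
      by (rule dir_deriv_cong_open[OF open_dom assms]) (rule loop_linear)
    also have "\<dots> = Re v *\<^sub>R dir_deriv (loop l 1) p w + Im v *\<^sub>R dir_deriv (loop l \<i>) p w"
      by (rule dir_deriv_eq[OF has_derivative_add[OF
            has_derivative_scaleR_right[OF smooth_on_has_derivative[OF smooth_loop assms]]
            has_derivative_scaleR_right[OF smooth_on_has_derivative[OF smooth_loop assms]]]])
    finally show ?thesis .
  qed
  show "curvature l p v w = Re v *\<^sub>R curvature l p 1 w + Im v *\<^sub>R curvature l p \<i> w"
    unfolding curvature_def d dir_deriv_complex[OF smooth_on_has_derivative[OF smooth_loop assms], of _ _ v]
      loop_linear[OF assms, of l v] comm_def
    by (simp add: mm.add_left mm.add_right mm.scaleR_left mm.scaleR_right algebra_simps)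
qed

text \<open>Divergence of the p-part, covariant for the connection given by the k-part. For a real
  frame this is, up to translation by the frame, the tension field of the induced map into
  SO(4)/(SO(2) x SO(2)).\<close>

definition obstruction :: "complex \<Rightarrow> complex^4^4" where
  "obstruction p = p_proj (dir_deriv (theta 1) p 1 + dir_deriv (theta \<i>) p \<i>)
    + comm (K 1 p) (P 1 p) + comm (K \<i> p) (P \<i> p)"

text \<open>The k-component and the cosine multiple of the p-component vanish by the Maurer-Cartan
  equation, and the sine multiple survives. The bracket of the p-parts keeps coefficient 1 because
  c^2 + s^2 = 1, which holds for every nonzero l.\<close>

lemma curvature_1_i:
  assumes p: "p \<in> D" and l: "l \<noteq> 0"
  shows "curvature l p 1 \<i> = - cscale (\<i> * (l - inverse l) / 2) (obstruction p)"
proof -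
  define c s where "c = (l + inverse l) / 2" and "s = \<i> * (l - inverse l) / 2"
  have cs: "c * c + s * s = 1"
    using l by (simp add: c_def s_def field_simps power2_eq_square)
  have th: "theta (- 1) q = - theta 1 q" if "q \<in> D" for q
    using theta_linear[OF that, of "- 1"] by simp
  have l1: "loop l 1 p = K 1 p + cscale c (P 1 p) + cscale s (P \<i> p)"
    by (simp add: loop_def c_def s_def)
  have l2: "loop l \<i> q = K \<i> q + cscale c (P \<i> q) - cscale s (P 1 q)" if "q \<in> D" for q
    using th[OF that] by (simp add: loop_def c_def s_def p_proj_simps cscale_simps)
  note lin = bounded_linear.has_derivative[OF bounded_linear_compose[OF bounded_linear_cscale linear_p_proj]
      smooth_on_has_derivative[OF smooth_theta p]]
    and link = bounded_linear.has_derivative[OF linear_k_proj smooth_on_has_derivative[OF smooth_theta p]]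
  have d1: "dir_deriv (loop l 1) p \<i> = k_proj (dir_deriv (theta 1) p \<i>) + cscale c (p_proj (dir_deriv (theta 1) p \<i>))
      + cscale s (p_proj (dir_deriv (theta \<i>) p \<i>))"
    unfolding loop_def[abs_def] c_def[symmetric] s_def[symmetric] mult_1_right
    by (rule dir_deriv_eq[OF has_derivative_add[OF has_derivative_add[OF link lin] lin]])
  have d2: "dir_deriv (loop l \<i>) p 1 = k_proj (dir_deriv (theta \<i>) p 1) + cscale c (p_proj (dir_deriv (theta \<i>) p 1))
      - cscale s (p_proj (dir_deriv (theta 1) p 1))"
  proof -
    have "dir_deriv (loop l \<i>) p 1 = dir_deriv (\<lambda>q. K \<i> q + cscale c (P \<i> q) - cscale s (P 1 q)) p 1"
      by (rule dir_deriv_cong_open[OF open_dom p]) (rule l2)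
    also have "\<dots> = k_proj (dir_deriv (theta \<i>) p 1) + cscale c (p_proj (dir_deriv (theta \<i>) p 1))
      - cscale s (p_proj (dir_deriv (theta 1) p 1))"
      by (rule dir_deriv_eq[OF has_derivative_diff[OF has_derivative_add[OF link lin] lin]])
    finally show ?thesis .
  qed
  note mc = maurer_cartan_equation[OF p, of \<i> 1]
  have mck: "k_proj (dir_deriv (theta \<i>) p 1) - k_proj (dir_deriv (theta 1) p \<i>)
      = - (comm (K 1 p) (K \<i> p) + comm (P 1 p) (P \<i> p))"
    using arg_cong[OF mc, of k_proj] by (simp add: k_proj_simps comm_def k_proj_mult)
  have mcp: "p_proj (dir_deriv (theta \<i>) p 1) - p_proj (dir_deriv (theta 1) p \<i>)
      = - (comm (K 1 p) (P \<i> p) + comm (P 1 p) (K \<i> p))"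
    using arg_cong[OF mc, of p_proj] by (simp add: p_proj_simps comm_def p_proj_mult)
  have "curvature l p 1 \<i> = (k_proj (dir_deriv (theta \<i>) p 1) - k_proj (dir_deriv (theta 1) p \<i>))
      + cscale c (p_proj (dir_deriv (theta \<i>) p 1) - p_proj (dir_deriv (theta 1) p \<i>))
      - cscale s (p_proj (dir_deriv (theta 1) p 1) + p_proj (dir_deriv (theta \<i>) p \<i>))
      + comm (loop l 1 p) (loop l \<i> p)"
    unfolding curvature_def d1 d2 by (simp add: cscale_simps)
  also have "\<dots> = - cscale s (obstruction p)"
    unfolding mck mcp l1 l2[OF p] comm_rotated cs obstruction_def
    by (simp add: vec_eq_iff p_proj_simps algebra_simps)
  finally show ?thesis by (simp add: s_def)
qed

lemma flat_iff_obstruction: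
  "(\<forall>l\<in>sphere 0 1. flat_connection D (loop_form (maurer_cartan M) l)) \<longleftrightarrow> (\<forall>p\<in>D. obstruction p = 0)"
proof
  assume L: "\<forall>l\<in>sphere 0 1. flat_connection D (loop_form (maurer_cartan M) l)"
  show "\<forall>p\<in>D. obstruction p = 0"
  proof
    fix p assume p: "p \<in> D"
    \<comment> \<open>At l = \<i> the factor in front of the obstruction has modulus 1; at l = 1 and
      l = -1 it would vanish.\<close>
    have "flat_connection D (loop_form (maurer_cartan M) \<i>)" using L by simp
    then have "curvature \<i> p 1 \<i> = 0" using p by (simp add: flat_connection_iff)
    then show "obstruction p = 0"
      unfolding curvature_1_i[OF p complex_i_not_zero] by (simp add: vec_eq_iff)
  qed
next
  assume R: "\<forall>p\<in>D. obstruction p = 0"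
  show "\<forall>l\<in>sphere 0 1. flat_connection D (loop_form (maurer_cartan M) l)"
    unfolding flat_connection_iff
  proof (intro ballI allI)
    fix l p v w assume "l \<in> sphere (0::complex) 1" and p: "p \<in> D"
    then have "l \<noteq> 0" by auto
    then show "curvature l p v w = 0"
      unfolding curvature_eq[OF p, of l v w] using curvature_1_i[OF p, of l] R p by (simp add: cscale_simps)
  qed
qed

lemma obstruction_skew:
  assumes "p \<in> D" shows "transpose (obstruction p) = - obstruction p"
proof -
  have d: "transpose (dir_deriv (theta v) p w) = - dir_deriv (theta v) p w" for v w
  proof -
    have "dir_deriv (\<lambda>q. transpose (theta v q)) p w = dir_deriv (\<lambda>q. - theta v q) p w"
      by (rule dir_deriv_cong_open[OF open_dom assms]) (rule theta_skew)
    then show ?thesis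
      by (simp add: dir_deriv_linear[OF bounded_linear_transpose smooth_theta assms]
          dir_deriv_linear[OF bounded_linear_minus[OF bounded_linear_ident] smooth_theta assms])
  qed
  have t: "transpose (k_proj A) = k_proj (transpose A)" "transpose (p_proj A) = p_proj (transpose A)" for A
    by (auto simp: vec_eq_iff transpose_def k_proj_nth p_proj_nth)
  have "transpose (comm A B) = - comm A B" if "transpose A = - A" "transpose B = - B" for A B
    using that by (simp add: comm_def transpose_simps matrix_transpose_mul mm.minus_left mm.minus_right)
  then have c: "transpose (comm (K v p) (P v p)) = - comm (K v p) (P v p)" for v
    by (simp add: t theta_skew[OF assms] k_proj_simps p_proj_simps)
  show ?thesis
    unfolding obstruction_def by (simp add: transpose_simps t d c p_proj_simps)
qed

text \<open>By \<open>dtheta\<close> the obstruction is the p-part of the transformed Laplacian of M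
  minus twice the products P K. In the lower left block these products involve only the upper left
  block of \<open>theta\<close>, which vanishes by assumption; the upper right block follows by
  skewness.\<close>

lemma obstruction_eq_0_iff:
  assumes "p \<in> D" and "\<And>v j k. j \<in> {1,2} \<Longrightarrow> k \<in> {1,2} \<Longrightarrow> theta v p $ j $ k = 0"
  shows "obstruction p = 0 \<longleftrightarrow> (\<forall>j\<in>{3,4}. \<forall>k\<in>{1,2}.
    (transpose (M p) ** (dir_deriv (\<lambda>q. dir_deriv M q 1) p 1 + dir_deriv (\<lambda>q. dir_deriv M q \<i>) p \<i>)) $ j $ k = 0)"
proof -
  define L where "L = transpose (M p) ** (dir_deriv (\<lambda>q. dir_deriv M q 1) p 1 + dir_deriv (\<lambda>q. dir_deriv M q \<i>) p \<i>)"
  have th: "theta v p $ 1 $ 1 = 0" "theta v p $ 1 $ 2 = 0" "theta v p $ 2 $ 1 = 0" "theta v p $ 2 $ 2 = 0" for v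
    by (rule assms(2); simp)+
  have o: "obstruction p = p_proj L - 2 *\<^sub>R (P 1 p ** K 1 p + P \<i> p ** K \<i> p)"
    unfolding obstruction_def dtheta[OF assms(1)] comm_def L_def mm.add_right
    by (simp add: p_proj_simps p_proj_mult scaleR_2)
  have l: "obstruction p $ j $ k = L $ j $ k" if "j = 3 \<or> j = 4" "k = 1 \<or> k = 2" for j k
  proof -
    have "(P v p ** K v p) $ j $ k = 0" for v
      using that by (elim disjE) (simp_all add: matrix_matrix_mult_def sum_4 p_proj_nth k_proj_nth th)
    moreover have "p_proj L $ j $ k = L $ j $ k" using that by (elim disjE) (simp_all add: p_proj_nth)
    ultimately show ?thesis unfolding o by simp
  qed
  have z: "obstruction p $ j $ k = 0" if "(j = 1 \<or> j = 2) = (k = 1 \<or> k = 2)" for j k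
  proof -
    have "(P v p ** K v p) $ j $ k = 0" for v
      using that exhaust_4[of j] exhaust_4[of k]
      by (elim disjE) (simp_all add: matrix_matrix_mult_def sum_4 p_proj_nth k_proj_nth)
    then show ?thesis unfolding o by (simp add: p_proj_nth that)
  qed
  have s: "obstruction p $ k $ j = - obstruction p $ j $ k" for j k
    using arg_cong[OF obstruction_skew[OF assms(1)], of "\<lambda>A. A $ j $ k"]
    by (simp only: transpose_def vec_lambda_beta vector_uminus_component)
  have "obstruction p = 0 \<longleftrightarrow> (\<forall>j\<in>{3,4}. \<forall>k\<in>{1,2}. obstruction p $ j $ k = 0)"
  proof
    assume R: "\<forall>j\<in>{3,4}. \<forall>k\<in>{1,2}. obstruction p $ j $ k = 0"
    have "obstruction p $ j $ k = 0" for j k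
    proof (cases "(j = 1 \<or> j = 2) = (k = 1 \<or> k = 2)")
      case False
      have c: "i \<in> {3,4}" if "\<not> (i = 1 \<or> i = 2)" for i :: 4
        using exhaust_4[of i] that by simp
      show ?thesis
      proof (cases "j = 1 \<or> j = 2")
        case True
        with False have "k \<in> {3,4}" by (intro c) simp
        moreover have "j \<in> {1,2}" using True by simp
        ultimately have "obstruction p $ k $ j = 0" using R by blast
        moreover have "obstruction p $ j $ k = - obstruction p $ k $ j" by (rule s)
        ultimately show ?thesis by simp
      next
        case j: False
        with False have "k \<in> {1,2}" by simp
        with c[OF j] show ?thesis using R by blast
      qed
    qed (rule z)
    then show "obstruction p = 0" by (simp add: vec_eq_iff)
  qed simp
  also have "\<dots> \<longleftrightarrow> (\<forall>j\<in>{3,4}. \<forall>k\<in>{1,2}. L $ j $ k = 0)"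
    by (intro ball_cong refl) (simp add: l)
  finally show ?thesis by (simp add: L_def)
qed

end

section \<open>The adapted frame\<close>

lemma bounded_linear_column: "bounded_linear (column k :: complex^4^4 \<Rightarrow> complex^4)"
  unfolding linear_conv_bounded_linear[symmetric]
  by (auto intro!: linearI simp: column_def vec_eq_iff)

lemma transpose_mult_nth: "(transpose A ** B) $ j $ k = bil (column j A) (column k B)"
  for A B :: "complex^4^4"
  by (simp add: matrix_matrix_mult_def transpose_def bil_def column_def)

lemma second_dir_deriv_linear:
  assumes "open S" "bounded_linear L" "smooth_on S g" "p \<in> S"
  shows "dir_deriv (\<lambda>q. dir_deriv (\<lambda>r. L (g r)) q v) p w = L (dir_deriv (\<lambda>q. dir_deriv g q v) p w)"
proof -
  have "dir_deriv (\<lambda>q. dir_deriv (\<lambda>r. L (g r)) q v) p w = dir_deriv (\<lambda>q. L (dir_deriv g q v)) p w"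
    by (rule dir_deriv_cong_open[OF assms(1,4)]) (rule dir_deriv_linear[OF assms(2,3)])
  then show ?thesis by (simp add: dir_deriv_linear[OF assms(2) smooth_on_dir_deriv[OF assms(3)] assms(4)])
qed

text \<open>With \<open>imag_col\<close>, the real and imaginary parts scaled by sqrt 2: real-linear
  maps, so that they commute with differentiation of the lift.\<close>

definition real_col :: "complex^4 \<Rightarrow> complex^4" where
  "real_col z = (1 / of_real (sqrt 2)) *s (z + conjv z)"

definition imag_col :: "complex^4 \<Rightarrow> complex^4" where
  "imag_col z = (- \<i> / of_real (sqrt 2)) *s (z - conjv z)"

lemma bounded_linear_real_col: "bounded_linear real_col" and bounded_linear_imag_col: "bounded_linear imag_col"
  unfolding real_col_def[abs_def] imag_col_def[abs_def]
  by (rule bounded_linear_compose[OF sm.bounded_linear_right bounded_linear_add[OF bounded_linear_ident bounded_linear_conjv]]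
      bounded_linear_compose[OF sm.bounded_linear_right bounded_linear_sub[OF bounded_linear_ident bounded_linear_conjv]])+

lemma frame_column:
  "column 1 (frame u F p) = real_col (F p)" "column 2 (frame u F p) = imag_col (F p)"
  "column 3 (frame u F p) = e3 u F p" "column 4 (frame u F p) = e4 u F p"
  by (simp_all add: column_def frame_def vec_eq_iff real_col_def imag_col_def)

context lagrangian_lift
begin

lemma wirt_z_horizontal: "p \<in> D \<Longrightarrow> wirt_z F p \<in> horizontal_space (F p)"
  using dF_horizontal by (simp add: wirt_z_def horizontal_space_def bil.diff_left)

lemma bil_wirt_z_conjv: "p \<in> D \<Longrightarrow> bil (wirt_z F p) (conjv (wirt_z F p)) = of_real (exp (u p))"
  by (simp add: wirt_z_def linear_simps[OF bounded_linear_conjv] bil.diff_left bil.diff_right bil.add_left bil.add_right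
      bil_dF_conjv_dF algebra_simps)

definition gap3 :: "complex \<Rightarrow> real" where "gap3 p = 2 * exp (u p) + 2 * Re (alpha F p)"
definition gap4 :: "complex \<Rightarrow> real" where "gap4 p = gap3 p * (exp (2 * u p) - (cmod (alpha F p))\<^sup>2)"

lemma gap_pos: assumes "p \<in> D" shows "gap3 p > 0" "gap4 p > 0"
proof -
  have g: "exp (2 * u p) - (cmod (alpha F p))\<^sup>2 > 0" using gap assms by blast
  then have "(cmod (alpha F p))\<^sup>2 < (exp (u p))\<^sup>2" by (simp add: exp_double)
  then have "cmod (alpha F p) < exp (u p)" by (rule power2_less_imp_less) simp
  then show "gap3 p > 0" using complex_Re_le_cmod[of "- alpha F p"] by (simp add: gap3_def)
  with g show "gap4 p > 0" by (simp add: gap4_def)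
qed

lemma orthonormal:
  assumes "p \<in> D"
  shows "bil (column j (frame u F p)) (column k (frame u F p)) = (if j = k then 1 else 0)"
proof -
  define q w a where "q = F p" and "w = wirt_z F p" and "a = alpha F p"
  define E where "E = complex_of_real (exp (u p))"
  define s t where "s = complex_of_real (sqrt (gap3 p))" and "t = complex_of_real (sqrt (gap4 p))"
  define n where "n = complex_of_real (sqrt 2)"
  have n: "n * n = 2" "n \<noteq> 0" by (simp_all add: n_def of_real_mult[symmetric] del: of_real_mult)
  have s: "s \<noteq> 0" "s * s = 2 * E + a + cnj a"
  proof -
    show "s \<noteq> 0" using gap_pos[OF assms] by (simp add: s_def)
    have "s * s = of_real (gap3 p)"
      using gap_pos[OF assms] unfolding s_def of_real_mult[symmetric] by (simp del: of_real_mult)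
    then show "s * s = 2 * E + a + cnj a" by (simp add: gap3_def E_def a_def complex_eq_iff)
  qed
  have t: "t \<noteq> 0" "t * t = (2 * E + a + cnj a) * (E * E - a * cnj a)"
  proof -
    show "t \<noteq> 0" using gap_pos[OF assms] by (simp add: t_def)
    have "t * t = of_real (gap4 p)"
      using gap_pos[OF assms] unfolding t_def of_real_mult[symmetric] by (simp del: of_real_mult)
    moreover have "of_real (gap3 p) = 2 * E + a + cnj a" by (simp add: gap3_def E_def a_def complex_eq_iff)
    moreover have "of_real (exp (2 * u p) - (cmod (alpha F p))\<^sup>2) = E * E - a * cnj a"
      by (simp add: E_def a_def exp_double complex_norm_square[symmetric] power2_eq_square)
    ultimately show "t * t = (2 * E + a + cnj a) * (E * E - a * cnj a)" by (simp only: gap4_def of_real_mult)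
  qed
  have qq: "bil q q = 0" "bil q (conjv q) = 1" "bil (conjv q) q = 1" "bil (conjv q) (conjv q) = 0"
    using norm_F[OF assms] bil_F_F[OF assms] bil_conjv_self[of q] cnj_bil[of q q]
    by (simp_all add: q_def bil_commute)
  have h: "w \<in> horizontal_space q" "conjv w \<in> horizontal_space q"
    using wirt_z_horizontal[OF assms] horizontal_space_conjv by (auto simp: w_def q_def)
  then have qw: "bil w q = 0" "bil w (conjv q) = 0" "bil (conjv w) q = 0" "bil (conjv w) (conjv q) = 0"
    "bil q w = 0" "bil (conjv q) w = 0" "bil q (conjv w) = 0" "bil (conjv q) (conjv w) = 0"
    by (auto simp: horizontal_space_def bil_commute)
  have ww: "bil w w = a" "bil w (conjv w) = E" "bil (conjv w) w = E" "bil (conjv w) (conjv w) = cnj a"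
    using bil_wirt_z_conjv[OF assms] cnj_bil[of w w]
    by (simp_all add: w_def a_def E_def alpha_def bil_commute[of "conjv _" "wirt_z F p"])
  have cols: "column 1 (frame u F p) = (1 / n) *s (q + conjv q)" "column 2 (frame u F p) = (- \<i> / n) *s (q - conjv q)"
    "column 3 (frame u F p) = (1 / s) *s (w + conjv w)"
    "column 4 (frame u F p) = (- \<i> / t) *s ((E + cnj a) *s w - (E + a) *s conjv w)"
    unfolding frame_column
    by (simp_all add: real_col_def imag_col_def e3_def e4_def n_def q_def w_def a_def E_def s_def t_def gap3_def gap4_def)
  note bs = bil.add_left bil.add_right bil.diff_left bil.diff_right bil.minus_left bil.minus_right
  have 11: "bil ((1 / n) *s (q + conjv q)) ((1 / n) *s (q + conjv q)) = 1"
    "bil ((- \<i> / n) *s (q - conjv q)) ((- \<i> / n) *s (q - conjv q)) = 1"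
    "bil ((1 / n) *s (q + conjv q)) ((- \<i> / n) *s (q - conjv q)) = 0"
    using n by (simp_all add: bs qq field_simps)
  have 33: "bil ((1 / s) *s (w + conjv w)) ((1 / s) *s (w + conjv w)) = 1"
  proof -
    have "bil (w + conjv w) (w + conjv w) = s * s" unfolding s(2) by (simp add: bs ww)
    then show ?thesis using s(1) by (simp only: bil_smult_left bil_smult_right) simp
  qed
  have 44: "bil ((- \<i> / t) *s ((E + cnj a) *s w - (E + a) *s conjv w)) ((- \<i> / t) *s ((E + cnj a) *s w - (E + a) *s conjv w)) = 1"
  proof -
    have *: "bil ((E + cnj a) *s w - (E + a) *s conjv w) ((E + cnj a) *s w - (E + a) *s conjv w) = - (t * t)"
      unfolding t(2) by (simp add: bs ww algebra_simps)
    show ?thesis unfolding bil_smult_left bil_smult_right * using t(1) by simp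
  qed
  \<comment> \<open>The coefficients in \<open>e4\<close> are the products of w +
    \<open>conjv w\<close> with \<open>conjv w\<close> and with w, so the two contributions
    cancel.\<close>
  have 34: "bil ((1 / s) *s (w + conjv w)) ((- \<i> / t) *s ((E + cnj a) *s w - (E + a) *s conjv w)) = 0"
    by (simp add: bs ww algebra_simps)
  have 13: "bil ((1 / n) *s (q + conjv q)) ((1 / s) *s (w + conjv w)) = 0"
    "bil ((- \<i> / n) *s (q - conjv q)) ((1 / s) *s (w + conjv w)) = 0"
    "bil ((1 / n) *s (q + conjv q)) ((- \<i> / t) *s ((E + cnj a) *s w - (E + a) *s conjv w)) = 0"
    "bil ((- \<i> / n) *s (q - conjv q)) ((- \<i> / t) *s ((E + cnj a) *s w - (E + a) *s conjv w)) = 0"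
    by (simp_all add: bs qw)
  let ?c = "\<lambda>k. column k (frame u F p)"
  note o = 11[folded cols] 33[folded cols] 44[folded cols] 34[folded cols] 13[folded cols]
  have "\<forall>j k. bil (?c j) (?c k) = (if j = k then 1 else 0)"
    unfolding forall_4
    by (simp add: o bil_commute[of "?c 2" "?c 1"] bil_commute[of "?c 3" "?c 1"] bil_commute[of "?c 4" "?c 1"]
        bil_commute[of "?c 3" "?c 2"] bil_commute[of "?c 4" "?c 2"] bil_commute[of "?c 4" "?c 3"])
  then show ?thesis by blast
qed

lemma smooth_frame: "smooth_on D (frame u F)"
proof -
  define x where "x = (\<lambda>q. bil (dir_deriv F q 1) (conjv (dir_deriv F q 1)))"
  have C: "Ck_on k D g" if "smooth_on D g" for k and g :: "complex \<Rightarrow> 'b::real_normed_vector"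
    using that by (simp add: smooth_on_def)
  have S: "smooth_on D g" if "\<And>k. Ck_on k D g" for g :: "complex \<Rightarrow> 'b::real_normed_vector"
    using that by (simp add: smooth_on_def)
  note lin = smooth_on_linear[OF _ open_D] and bilin = smooth_on_bilinear[OF _ open_D]
  \<comment> \<open>Smoothness of exp u is read off from the metric: it is half the squared norm of
    F_x.\<close>
  have expu: "smooth_on D (\<lambda>q. exp (u q))"
  proof (rule smooth_on_cong[OF open_D])
    show "smooth_on D (\<lambda>q. (1/2) *\<^sub>R Re (x q))"
      unfolding x_def
      by (rule lin[OF bounded_linear_scaleR_right lin[OF bounded_linear_Re
          smooth_on_bil[OF open_D smooth_dF smooth_on_conjv[OF open_D smooth_dF]]]])
    show "(1/2) *\<^sub>R Re (x q) = exp (u q)" if "q \<in> D" for q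
      by (simp add: x_def bil_dF_conjv_dF[OF that])
  qed
  have g3: "smooth_on D gap3"
    unfolding gap3_def[abs_def]
    by (rule smooth_on_add[OF open_D lin[OF bounded_linear_mult_right expu]
          lin[OF bounded_linear_mult_right lin[OF bounded_linear_Re smooth_alpha]]])
  have e: "gap3 q * (exp (u q) * exp (u q) + (- 1) * (alpha F q \<bullet> alpha F q)) = gap4 q" for q
    by (simp add: gap4_def exp_double power2_eq_square dot_square_norm)
  have g4: "smooth_on D (\<lambda>q. gap3 q * (exp (u q) * exp (u q) + (- 1) * (alpha F q \<bullet> alpha F q)))"
    by (rule bilin[OF bounded_bilinear_mult g3 smooth_on_add[OF open_D bilin[OF bounded_bilinear_mult expu expu]
       lin[OF bounded_linear_mult_right bilin[OF bounded_bilinear_inner smooth_alpha smooth_alpha]]]])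
  have r: "smooth_on D (\<lambda>q. complex_of_real (inverse (sqrt (g q))))" if "smooth_on D g" "\<And>q. q \<in> D \<Longrightarrow> g q > 0" for g
  proof (rule lin[OF bounded_linear_of_real S])
    fix k
    have "Ck_on k D (\<lambda>q. sqrt (g q))" by (rule Ck_on_sqrt[OF open_D that(2) C[OF that(1)]])
    then show "Ck_on k D (\<lambda>q. inverse (sqrt (g q)))"
    proof (rule Ck_on_inverse[OF open_D, rotated])
      show "sqrt (g q) \<noteq> 0" if "q \<in> D" for q
        using \<open>\<And>q. q \<in> D \<Longrightarrow> g q > 0\<close>[OF that] by simp
    qed
  qed
  have c3: "smooth_on D (e3 u F)"
  proof -
    have "smooth_on D (\<lambda>q. complex_of_real (inverse (sqrt (gap3 q))) *s (wirt_z F q + conjv (wirt_z F q)))"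
      by (rule bilin[OF sm.bounded_bilinear_axioms r[OF g3 gap_pos(1)]
            smooth_on_add[OF open_D smooth_wirt_z lin[OF bounded_linear_conjv smooth_wirt_z]]])
    then show ?thesis by (simp add: e3_def[abs_def] gap3_def inverse_eq_divide)
  qed
  have c4: "smooth_on D (e4 u F)"
  proof -
    let ?E = "\<lambda>q. complex_of_real (exp (u q))"
    have E: "smooth_on D ?E" by (rule lin[OF bounded_linear_of_real expu])
    have "smooth_on D (\<lambda>q. (- \<i> * complex_of_real (inverse (sqrt (gap4 q)))) *s ((?E q + cnj (alpha F q)) *s wirt_z F q
        + (- 1) *s ((?E q + alpha F q) *s conjv (wirt_z F q))))"
      by (rule bilin[OF sm.bounded_bilinear_axioms lin[OF bounded_linear_mult_right r[OF g4[unfolded e] gap_pos(2)]]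
            smooth_on_add[OF open_D
             bilin[OF sm.bounded_bilinear_axioms smooth_on_add[OF open_D E lin[OF bounded_linear_cnj smooth_alpha]] smooth_wirt_z]
             lin[OF sm.bounded_linear_right
              bilin[OF sm.bounded_bilinear_axioms smooth_on_add[OF open_D E smooth_alpha] lin[OF bounded_linear_conjv smooth_wirt_z]]]]])
    moreover have "(- \<i> * complex_of_real (inverse (sqrt (gap4 q)))) *s ((?E q + cnj (alpha F q)) *s wirt_z F q
        + (- 1) *s ((?E q + alpha F q) *s conjv (wirt_z F q))) = e4 u F q" for q
      by (simp add: e4_def gap4_def gap3_def divide_inverse vec_eq_iff algebra_simps)
    ultimately show ?thesis by simp
  qed
  have c: "smooth_on D (\<lambda>q. column k (frame u F q))" for k
    using exhaust_4[of k] c3 c4 lin[OF bounded_linear_real_col smooth_F] lin[OF bounded_linear_imag_col smooth_F]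
    by (auto simp: frame_column)
  have nth: "frame u F q = (\<chi> j k. column k (frame u F q) $ j)" for q
    by (simp add: vec_eq_iff column_def)
  show ?thesis
    by (subst nth[abs_def], rule S, rule Ck_on_vec[OF open_D], rule Ck_on_vec[OF open_D], rule Ck_on_nth[OF open_D], rule C[OF c])
qed

sublocale frame: orthogonal_frame D "frame u F"
proof
  show "transpose (frame u F q) ** frame u F q = mat 1" if "q \<in> D" for q
    by (simp add: vec_eq_iff transpose_mult_nth orthonormal[OF that] mat_def)
qed (rule open_D smooth_frame)+

lemma obstruction_eq_0_iff_hmc:
  assumes p: "p \<in> D" shows "frame.obstruction p = 0 \<longleftrightarrow> hmc p = 0"
proof -
  let ?c = "\<lambda>k. column k (frame u F p)"
  have dcol: "column k (dir_deriv (frame u F) p v) = dir_deriv (\<lambda>q. column k (frame u F q)) p v" for k v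
    by (rule dir_deriv_linear[OF bounded_linear_column smooth_frame p, symmetric])
  \<comment> \<open>The first two columns lie in the span of F and its conjugate, while their
    derivatives are horizontal.\<close>
  have zero: "frame.theta v p $ j $ k = 0" if "j \<in> {1,2}" "k \<in> {1,2}" for v j k
  proof -
    have z: "dir_deriv F p v \<in> horizontal_space (F p)" "conjv (dir_deriv F p v) \<in> horizontal_space (F p)"
      using dF_horizontal[OF p] horizontal_space_conjv by auto
    have "bil (?c j) w = 0" if "w \<in> horizontal_space (F p)" for w
      using that \<open>j \<in> {1,2}\<close>
      by (auto simp: frame_column real_col_def imag_col_def horizontal_space_def bil.add_right bil.diff_right bil_commute[of _ w])
    moreover have "real_col (dir_deriv F p v) \<in> horizontal_space (F p)" "imag_col (dir_deriv F p v) \<in> horizontal_space (F p)"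
      using z by (simp_all add: real_col_def imag_col_def horizontal_space_def bil.add_left bil.diff_left)
    moreover have "column k (dir_deriv (frame u F) p v) \<in> {real_col (dir_deriv F p v), imag_col (dir_deriv F p v)}"
      unfolding dcol using \<open>k \<in> {1,2}\<close>
      by (auto simp: frame_column dir_deriv_linear[OF bounded_linear_real_col smooth_F p]
          dir_deriv_linear[OF bounded_linear_imag_col smooth_F p])
    ultimately show ?thesis unfolding frame.theta_def transpose_mult_nth by auto
  qed
  let ?L = "dir_deriv (\<lambda>q. dir_deriv (frame u F) q 1) p 1 + dir_deriv (\<lambda>q. dir_deriv (frame u F) q \<i>) p \<i>"
  have "column k ?L = dir_deriv (\<lambda>q. dir_deriv (\<lambda>r. column k (frame u F r)) q 1) p 1
      + dir_deriv (\<lambda>q. dir_deriv (\<lambda>r. column k (frame u F r)) q \<i>) p \<i>" for k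
    by (simp add: linear_simps[OF bounded_linear_column] second_dir_deriv_linear[OF open_D bounded_linear_column smooth_frame p])
  then have L: "column 1 ?L = real_col (lap p)" "column 2 ?L = imag_col (lap p)"
    by (simp_all add: frame_column lap_def
        second_dir_deriv_linear[OF open_D bounded_linear_real_col smooth_F p] linear_simps[OF bounded_linear_real_col]
        second_dir_deriv_linear[OF open_D bounded_linear_imag_col smooth_F p] linear_simps[OF bounded_linear_imag_col])
  have eh: "?c j \<in> horizontal_space (F p)" if "j \<in> {3,4}" for j
    using that wirt_z_horizontal[OF p] horizontal_space_conjv[OF wirt_z_horizontal[OF p]]
    by (auto simp: frame_column e3_def e4_def horizontal_space_def bil.add_left bil.diff_left bil.minus_left)
  have ri: "bil e (real_col z) = 0 \<and> bil e (imag_col z) = 0 \<longleftrightarrow> bil e z = 0 \<and> bil e (conjv z) = 0" for e z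
    by (auto simp: real_col_def imag_col_def bil.add_right bil.diff_right)
  have "frame.obstruction p = 0 \<longleftrightarrow> (\<forall>j\<in>{3,4}. bil (?c j) (real_col (lap p)) = 0 \<and> bil (?c j) (imag_col (lap p)) = 0)"
    by (rule trans[OF frame.obstruction_eq_0_iff[OF p zero]])
      (auto simp only: transpose_mult_nth L ball_simps insert_iff empty_iff)
  also have "\<dots> \<longleftrightarrow> (\<forall>j\<in>{3,4}. bil (?c j) (lap p) = 0 \<and> bil (?c j) (conjv (lap p)) = 0)"
    unfolding ri ..
  also have "\<dots> \<longleftrightarrow> hmc p = 0"
  proof
    assume 0: "hmc p = 0"
    \<comment> \<open>Pairing with a horizontal vector sees only the horizontal part of the
      Laplacian. Products with the conjugated Laplacian reduce to this one, as conjugation preserves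
      the horizontal space.\<close>
    have "bil z (lap p) = 0" if "z \<in> horizontal_space (F p)" for z
      using bil_horizontal_proj[OF that, of "lap p"] 0 by (simp add: hmc_def bil.zero_left bil_commute[of z])
    moreover have "bil z (conjv (lap p)) = cnj (bil (conjv z) (lap p))" for z
      by (simp add: cnj_bil)
    ultimately show "\<forall>j\<in>{3,4}. bil (?c j) (lap p) = 0 \<and> bil (?c j) (conjv (lap p)) = 0"
      using eh horizontal_space_conjv by simp
  next
    assume 0: "\<forall>j\<in>{3,4}. bil (?c j) (lap p) = 0 \<and> bil (?c j) (conjv (lap p)) = 0"
    have "bil (hmc p) (?c j) = bil (lap p) (?c j)" if "j \<in> {3,4}" for j
      unfolding hmc_def by (rule bil_horizontal_proj[OF eh[OF that]])
    then have 34: "bil (hmc p) (?c 3) = 0" "bil (hmc p) (?c 4) = 0"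
      using 0 by (simp_all add: bil_commute[of "lap p"])
    \<comment> \<open>Expansion in the frame: the first two coefficients vanish because h is
      horizontal, the last two by assumption.\<close>
    have "hmc p = (\<Sum>k\<in>UNIV. bil (hmc p) (?c k) *s ?c k)"
      by (rule dual_basis_expand) (rule orthonormal[OF p])
    also have "\<dots> = 0"
      using 34 hmc_horizontal[OF p]
      by (simp add: sum_4 frame_column real_col_def imag_col_def horizontal_space_def bil.add_right bil.diff_right)
    finally show "hmc p = 0" .
  qed
  finally show ?thesis .
qed

lemma flat_iff:
  "(\<forall>l\<in>sphere 0 1. flat_connection D (loop_form (maurer_cartan (frame u F)) l)) \<longleftrightarrow> (\<forall>p\<in>D. hmc p = 0)"
  unfolding frame.flat_iff_obstruction by (simp add: obstruction_eq_0_iff_hmc)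

end

theorem theorem1p4:
  fixes D :: "complex set"
    and f :: "complex \<Rightarrow> complex^4^4"
    and F :: "complex \<Rightarrow> complex^4"
    and u :: "complex \<Rightarrow> real"
  assumes "open D" and "D \<noteq> {}" and "simply_connected D"
    and "immersion_into Q2 D f" and "conformal_map D f" and "lagrangian_map D f"
    and "induced_metric_is D f u"
    and "horizontal_lift D f F"
    and "\<forall>p\<in>D. exp (2 * u p) - (cmod (alpha F p))\<^sup>2 > 0"
  shows
    "(minimal_in Q2 D f \<longleftrightarrow>
        (\<forall>l\<in>sphere 0 1. flat_connection D (loop_form (maurer_cartan (frame u F)) l))) \<and>
     ((\<forall>l\<in>sphere 0 1. flat_connection D (loop_form (maurer_cartan (frame u F)) l)) \<longleftrightarrow>
        (alpha F holomorphic_on D \<and> (\<lambda>p. Arg (beta F p)) constant_on D))"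
proof -
  interpret lagrangian_lift D f F u
    using assms simply_connected_imp_connected by unfold_locales auto
  show ?thesis
    unfolding flat_iff minimal_iff Arg_beta_constant_iff using alpha_holomorphic by blast
qed

end
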